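(* Let $k\geq 0$ and $d\geq 1$ be integers, let $c_{2k+1}(Q_d)$ be the $(2k+1)$-cone of the hypercube $Q_d$, and let $s$ be the unique vertex of $c_{2k+1}(Q_d)$ not in $V(Q_d)$. Then \[ SP(c_{2k+1}(Q_d),s)\cong \bigoplus_{i=0}^{d} \mathbb{Z}_{2i+2k+1}^{\binom{d}{i}}. \] Furthermore, for $k=0$ (the cone $c(Q_d)=c_1(Q_d)$), $SP(c(Q_{d}),s)$ is the internal direct sum of its subgroups $\widetilde{K}_{\beta}$: \[ SP(c(Q_{d}),s)=\bigoplus_{\beta \in \{0,1\}^d} \widetilde{K}_{\beta}. \]
   Context: $Q_d$ is the hypercube with vertex set $\{v_{\bf a} : {\bf a}\in\{0,1\}^d\}$, where $v_{\bf a}$ and $v_{{\bf a}'}$ are adjacent iff ${\bf a}$ and ${\bf a}'$ differ in exactly one coordinate. The $n$-cone $c_n(G)$ of a graph $G$ is obtained by adding a new vertex $s$ and $n$ parallel edges between $s$ and each vertex of $G$; $c(G)=c_1(G)$. $\mathbb{Z}_m$ is the cyclic group of order $m$. Sandpile group of a connected multigraph $\Gamma$ with sink $s$: let $\widetilde V=V(\Gamma)\setminus\{s\}$ and $m_{u,v}$ the number of edges joining $u$ and $v$. A configuration is a vector ${\bf c}\in\mathbb{N}^{\widetilde V}$ (with $0\in\mathbb{N}$). A vertex $v\in\widetilde V$ is stable in ${\bf c}$ if ${\bf c}_v<d_\Gamma(v)$ (degree in $\Gamma$, counting multiplicities) and unstable otherwise; ${\bf c}$ is stable if all $v\in\widetilde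 V$ are stable. Toppling an unstable vertex $u$ decreases ${\bf c}_u$ by $d_\Gamma(u)$ and increases ${\bf c}_v$ by $m_{u,v}$ for every $v\in\widetilde V\setminus\{u\}$. Every configuration reaches by topplings of unstable vertices a unique stable configuration $s({\bf c})$. A configuration ${\bf c}$ is recurrent if it is stable and there is a non-zero configuration ${\bf r}$ such that $s({\bf c}+{\bf r})={\bf c}$. The sandpile group $SP(\Gamma,s)$ is the set of recurrent configurations with the operation ${\bf c}\oplus{\bf d}=s({\bf c}+{\bf d})$; it is a finite abelian group (here $\Gamma\setminus s$ is connected), and it is isomorphic to $\mathbb{Z}^{\widetilde V}/\mathrm{Im}\,L(\Gamma,s)^t$, where $L(\Gamma,s)$ is the Laplacian matrix of $\Gamma$ with the row and column of $s$ removed. For $\beta\in\{0,1\}^d$ let $|\beta|=\sum_i\beta_i$ and $\beta\cdot{\bf a}=\sum_i\beta_i{\bf a}_i$, and for $r,t\in\mathbb{N}$ let $g_\beta(r,t)\in\mathbb{N}^{V(Q_d)}$ be given by $g_{\beta}(r,t)_{v_{\bf a}}=r$ if $\beta\cdot{\bf a}$ is even and $g_{\beta}(r,t)_{v_{\bf a}}=t$ if $\beta\cdot{\bf a}$ is odd. Let ${\bf 1}$ be the all-ones vector. Then \[ \widetilde{K}_{\beta}=\{ g_{\beta} (r,t)+ (d-|\beta|){\bf 1}\: :\: 0\leq r,t \leq |\beta| \text{ and either } r=|\beta| \text{ or } t=|\beta| \}, \] which is a subgroup of $SP(c(Q_d),s)$. *)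

theory Defs
  imports "HOL-Algebra.Algebra"
begin

section \<open>Multigraphs\<close>

text \<open>
  A multigraph is given by its vertex set and the function sending \<open>u\<close>, \<open>v\<close> to the number of
  edges joining them. There are no loops.
\<close>

record 'v mgraph =
  vertices :: "'v set"
  nedges :: "'v \<Rightarrow> 'v \<Rightarrow> nat"

definition multigraph :: "'v mgraph \<Rightarrow> bool" where
  "multigraph \<Gamma> \<longleftrightarrow>
     finite (vertices \<Gamma>) \<and>
     (\<forall>u v. nedges \<Gamma> u v = nedges \<Gamma> v u) \<and>
     (\<forall>v. nedges \<Gamma> v v = 0) \<and>
     (\<forall>u v. nedges \<Gamma> u v \<noteq> 0 \<longrightarrow> u \<in> vertices \<Gamma> \<and> v \<in> vertices \<Gamma>)"

definition vertex_degree :: "'v mgraph \<Rightarrow> 'v \<Rightarrow> nat" where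
  "vertex_degree \<Gamma> v = (\<Sum>u\<in>vertices \<Gamma>. nedges \<Gamma> v u)"

text \<open>The new vertex is \<open>None\<close>; a vertex \<open>v\<close> of \<open>G\<close> becomes \<open>Some v\<close>.\<close>

definition n_cone :: "nat \<Rightarrow> 'v mgraph \<Rightarrow> 'v option mgraph" where
  "n_cone n G =
     \<lparr>vertices = insert None (Some ` vertices G),
      nedges = (\<lambda>x y. case (x, y) of
          (Some u, Some v) \<Rightarrow> nedges G u v
        | (None, Some v) \<Rightarrow> (if v \<in> vertices G then n else 0)
        | (Some u, None) \<Rightarrow> (if u \<in> vertices G then n else 0)
        | (None, None) \<Rightarrow> 0)\<rparr>"

definition bit_vectors :: "nat \<Rightarrow> nat list set" where
  "bit_vectors d = {a. length a = d \<and> set a \<subseteq> {0, 1}}"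

text \<open>The vertex \<open>v\<^sub>a\<close> is identified with \<open>a\<close>.\<close>

definition hypercube :: "nat \<Rightarrow> nat list mgraph" where
  "hypercube d =
     \<lparr>vertices = bit_vectors d,
      nedges = (\<lambda>a b. if a \<in> bit_vectors d \<and> b \<in> bit_vectors d
                        \<and> card {i. i < d \<and> a ! i \<noteq> b ! i} = 1
                      then 1 else 0)\<rparr>"

lemma multigraph_hypercube: "multigraph (hypercube d)"
proof -
  have "finite {a. set a \<subseteq> {0, 1::nat} \<and> length a = d}"
    by (rule finite_lists_length_eq) simp
  then have "finite (bit_vectors d)"
    by (rule rev_finite_subset) (auto simp: bit_vectors_def)
  moreover have "{i. i < d \<and> a ! i \<noteq> b ! i} = {i. i < d \<and> b ! i \<noteq> a ! i}" for a b :: "nat list"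
    by (intro Collect_cong conj_cong refl neq_commute)
  ultimately show ?thesis
    by (simp add: multigraph_def hypercube_def conj_left_commute)
qed

lemma multigraph_n_cone: "multigraph G \<Longrightarrow> multigraph (n_cone n G)"
  by (auto simp: multigraph_def n_cone_def split: option.splits if_splits)


section \<open>The sandpile group\<close>

definition nonsink :: "'v mgraph \<Rightarrow> 'v \<Rightarrow> 'v set" where
  "nonsink \<Gamma> s = vertices \<Gamma> - {s}"

text \<open>
  A vector indexed by the non-sink vertices is encoded as a function on the whole type that is \<open>0\<close>
  elsewhere, so that equality and addition of configurations are pointwise.
\<close>

definition configurations :: "'v mgraph \<Rightarrow> 'v \<Rightarrow> ('v \<Rightarrow> nat) set" where
  "configurations \<Gamma> s = {c. \<forall>v. v \<notin> nonsink \<Gamma> s \<longrightarrow> c v = 0}"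

definition stable_vertex :: "'v mgraph \<Rightarrow> ('v \<Rightarrow> nat) \<Rightarrow> 'v \<Rightarrow> bool" where
  "stable_vertex \<Gamma> c v \<longleftrightarrow> c v < vertex_degree \<Gamma> v"

definition stable :: "'v mgraph \<Rightarrow> 'v \<Rightarrow> ('v \<Rightarrow> nat) \<Rightarrow> bool" where
  "stable \<Gamma> s c \<longleftrightarrow> (\<forall>v\<in>nonsink \<Gamma> s. stable_vertex \<Gamma> c v)"

definition topple :: "'v mgraph \<Rightarrow> 'v \<Rightarrow> 'v \<Rightarrow> ('v \<Rightarrow> nat) \<Rightarrow> ('v \<Rightarrow> nat)" where
  "topple \<Gamma> s u c =
     (\<lambda>v. if v = u then c u - vertex_degree \<Gamma> u
          else if v \<in> nonsink \<Gamma> s then c v + nedges \<Gamma> u v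
          else c v)"

definition toppling :: "'v mgraph \<Rightarrow> 'v \<Rightarrow> ('v \<Rightarrow> nat) \<Rightarrow> ('v \<Rightarrow> nat) \<Rightarrow> bool" where
  "toppling \<Gamma> s c c' \<longleftrightarrow>
     (\<exists>u\<in>nonsink \<Gamma> s. \<not> stable_vertex \<Gamma> c u \<and> c' = topple \<Gamma> s u c)"

definition stabilization :: "'v mgraph \<Rightarrow> 'v \<Rightarrow> ('v \<Rightarrow> nat) \<Rightarrow> ('v \<Rightarrow> nat)" where
  "stabilization \<Gamma> s c = (THE c'. (toppling \<Gamma> s)\<^sup>*\<^sup>* c c' \<and> stable \<Gamma> s c')"

definition recurrent :: "'v mgraph \<Rightarrow> 'v \<Rightarrow> ('v \<Rightarrow> nat) \<Rightarrow> bool" where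
  "recurrent \<Gamma> s c \<longleftrightarrow>
     c \<in> configurations \<Gamma> s \<and> stable \<Gamma> s c \<and>
     (\<exists>r\<in>configurations \<Gamma> s. r \<noteq> (\<lambda>v. 0) \<and> stabilization \<Gamma> s (\<lambda>v. c v + r v) = c)"

text \<open>
  The group structure determines its neutral element, which in general is not the zero
  configuration; hence the definite description in the field \<open>one\<close>.
\<close>

definition sandpile_group :: "'v mgraph \<Rightarrow> 'v \<Rightarrow> ('v \<Rightarrow> nat) monoid" where
  "sandpile_group \<Gamma> s =
     \<lparr>carrier = {c. recurrent \<Gamma> s c},
      monoid.mult = (\<lambda>c c'. stabilization \<Gamma> s (\<lambda>v. c v + c' v)),
      one = (THE e. recurrent \<Gamma> s e \<and>
               (\<forall>c. recurrent \<Gamma> s c \<longrightarrow>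
                  stabilization \<Gamma> s (\<lambda>v. e v + c v) = c \<and>
                  stabilization \<Gamma> s (\<lambda>v. c v + e v) = c))\<rparr>"


section \<open>Internal direct sums\<close>

text \<open>
  An abelian group is the internal direct sum of a finite family of subgroups if every element is in
  exactly one way a sum of one element from each subgroup.
\<close>

definition internal_direct_sum ::
    "('a, 'm) monoid_scheme \<Rightarrow> 'i set \<Rightarrow> ('i \<Rightarrow> 'a set) \<Rightarrow> bool" where
  "internal_direct_sum G I K \<longleftrightarrow>
     comm_group G \<and> finite I \<and> (\<forall>i\<in>I. subgroup (K i) G) \<and>
     (\<forall>x\<in>carrier G. \<exists>!f. f \<in> (\<Pi>\<^sub>E i\<in>I. K i) \<and> finprod G f I = x)"


section \<open>The subgroups indexed by bit vectors\<close>

definition dot :: "nat list \<Rightarrow> nat list \<Rightarrow> nat" where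
  "dot b a = (\<Sum>i<length b. b ! i * a ! i)"

text \<open>
  Vectors indexed by the vertices of the cube are configurations on its cone, hence functions on the
  option type. For a bit vector \<open>b\<close>, the number \<open>|b|\<close> is \<open>sum_list b\<close>.
\<close>

definition g_conf :: "nat \<Rightarrow> nat list \<Rightarrow> nat \<Rightarrow> nat \<Rightarrow> nat list option \<Rightarrow> nat" where
  "g_conf d b r t x = (case x of
       None \<Rightarrow> 0
     | Some a \<Rightarrow> if a \<in> bit_vectors d then (if even (dot b a) then r else t) else 0)"

definition ones_conf :: "nat \<Rightarrow> nat list option \<Rightarrow> nat" where
  "ones_conf d x = (if x \<in> Some ` bit_vectors d then 1 else 0)"

text \<open>The subtraction does not truncate, since \<open>|b| \<le> d\<close> for a bit vector \<open>b\<close> of length \<open>d\<close>.\<close>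

definition K_tilde :: "nat \<Rightarrow> nat list \<Rightarrow> (nat list option \<Rightarrow> nat) set" where
  "K_tilde d b =
     {(\<lambda>x. g_conf d b r t x + (d - sum_list b) * ones_conf d x) | r t.
        r \<le> sum_list b \<and> t \<le> sum_list b \<and> (r = sum_list b \<or> t = sum_list b)}"

end

theory Submission
  imports Defs "HOL-Number_Theory.Cong"
begin

text \<open>
  In a connected graph, a stable configuration is recurrent iff firing the sink and stabilizing gives
  it back. Hence every class modulo the image of the Laplacian contains exactly one recurrent
  configuration. For a cone over the cube the characters \<open>\<chi>\<^sub>b(a) = (-1)\<^bsup>b\<cdot>a\<^esup>\<close> are eigenvectors of
  the Laplacian with eigenvalues \<open>2|b| + n\<close>, so the pairing \<open>\<langle>\<chi>\<^sub>b, z\<rangle>\<close> modulo \<open>2|b| + n\<close> is an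
  invariant of the class of \<open>z\<close>. If all these invariants vanish, Fourier inversion shows that \<open>2\<^sup>d z\<close>
  lies in the image of the Laplacian; as \<open>n\<close> is odd, the Laplacian is an involution modulo 2, so \<open>z\<close>
  itself lies in the image. Since 2 is invertible modulo the odd eigenvalues, all values of the
  invariants occur. For \<open>n = 1\<close>, the set \<open>K\<^sub>b\<close> consists of the recurrent configurations for which
  all invariants except the one at \<open>b\<close> vanish.
\<close>

section \<open>Recurrent configurations and the Laplacian\<close>

text \<open>\<open>sink_adjacent\<close> makes each toppling lose chips to the sink and lets
  repeated firings of the sink load every vertex directly. Connectivity is stated through vertex
  sets closed under adjacency, the form used in \<open>spread_vertex\<close>.\<close>

locale sandpile =
  fixes \<Gamma> :: "'v mgraph" and s :: 'v
  assumes multigraph: "multigraph \<Gamma>"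
    and sink: "s \<in> vertices \<Gamma>"
    and sink_adjacent: "v \<in> nonsink \<Gamma> s \<Longrightarrow> nedges \<Gamma> s v > 0"
    and nonsink_nonempty: "nonsink \<Gamma> s \<noteq> {}"
    and nonsink_connected:
      "\<lbrakk>S \<subseteq> nonsink \<Gamma> s; S \<noteq> {};
        \<And>u v. \<lbrakk>u \<in> S; v \<in> nonsink \<Gamma> s; nedges \<Gamma> u v > 0\<rbrakk> \<Longrightarrow> v \<in> S\<rbrakk> \<Longrightarrow> S = nonsink \<Gamma> s"
begin

abbreviation N :: "'v set" where "N \<equiv> nonsink \<Gamma> s"
abbreviation E :: "'v \<Rightarrow> 'v \<Rightarrow> nat" where "E \<equiv> nedges \<Gamma>"
abbreviation deg :: "'v \<Rightarrow> nat" where "deg \<equiv> vertex_degree \<Gamma>"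
abbreviation T :: "('v \<Rightarrow> nat) \<Rightarrow> ('v \<Rightarrow> nat) \<Rightarrow> bool" where "T \<equiv> toppling \<Gamma> s"
abbreviation stab :: "('v \<Rightarrow> nat) \<Rightarrow> 'v \<Rightarrow> nat" where "stab \<equiv> stabilization \<Gamma> s"

lemma finite_N: "finite N"
  using multigraph by (simp add: multigraph_def nonsink_def)

lemma E_sym: "E u v = E v u"
  using multigraph by (simp add: multigraph_def)

lemma E_self [simp]: "E v v = 0"
  using multigraph by (simp add: multigraph_def)

lemma E_sink_outside: "v \<notin> N \<Longrightarrow> E s v = 0"
  using multigraph E_self by (fastforce simp: multigraph_def nonsink_def)

section \<open>The reduced Laplacian and single topplings\<close>

lemma deg_eq: "deg v = E s v + (\<Sum>u\<in>N. E v u)"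
proof -
  have "vertices \<Gamma> = insert s N" "s \<notin> N"
    using sink by (auto simp: nonsink_def)
  then show ?thesis
    using finite_N by (simp add: vertex_degree_def E_sym)
qed

text \<open>The reduced Laplacian as an operator on total functions. It is meant at \<open>v\<close>
  in \<open>N\<close>, where it depends only on the values of \<open>x\<close> on \<open>N\<close>;
  edges to the sink enter through the degree alone.\<close>

definition lap :: "('v \<Rightarrow> int) \<Rightarrow> 'v \<Rightarrow> int" where
  "lap x v = int (deg v) * x v - (\<Sum>u\<in>N. int (E v u) * x u)"

lemma lap_add: "lap (\<lambda>v. x v + y v) v = lap x v + lap y v"
  by (simp add: lap_def algebra_simps sum.distrib)

lemma lap_diff: "lap (\<lambda>v. x v - y v) v = lap x v - lap y v"
  by (simp add: lap_def algebra_simps sum_subtractf)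

lemma lap_scale: "lap (\<lambda>v. c * x v) v = c * lap x v"
  by (simp add: lap_def algebra_simps sum_distrib_left)

lemma lap_cong: "(\<And>u. u \<in> N \<Longrightarrow> x u = y u) \<Longrightarrow> v \<in> N \<Longrightarrow> lap x v = lap y v"
  by (simp add: lap_def)

lemma lap_const: "lap (\<lambda>_. c) v = c * int (E s v)"
  by (simp add: lap_def deg_eq algebra_simps sum_distrib_left)

lemma lap_unit:
  assumes "u \<in> N"
  shows "lap (\<lambda>w. if w = u then 1 else 0) v = (if v = u then int (deg u) else - int (E u v))"
  using assms finite_N E_sym[of v u] by (auto simp: lap_def if_distrib cong: if_cong)

lemma toppling_lap:
  assumes "T c c'"
  obtains u where "u \<in> N" "deg u \<le> c u"
    "\<And>v. v \<in> N \<Longrightarrow> int (c' v) = int (c v) - lap (\<lambda>w. if w = u then 1 else 0) v"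
    "\<And>v. v \<notin> N \<Longrightarrow> c' v = c v"
proof -
  obtain u where u: "u \<in> N" "deg u \<le> c u" "c' = topple \<Gamma> s u c"
    using assms by (auto simp: toppling_def stable_vertex_def not_less)
  show thesis
    by (rule that[OF u(1,2)]) (use u in \<open>auto simp: topple_def lap_unit\<close>)
qed

section \<open>Termination and confluence of toppling\<close>

lemma topplingI: "u \<in> N \<Longrightarrow> deg u \<le> c u \<Longrightarrow> T c (topple \<Gamma> s u c)"
  unfolding toppling_def stable_vertex_def not_less by blast

text \<open>At least one of the \<open>deg u\<close> chips leaving \<open>u\<close> goes to the
  sink, so the total on \<open>N\<close> is a termination measure.\<close>

lemma toppling_decreases:
  assumes "T c c'"
  shows "sum c' N < sum c N"
proof -
  obtain u where u: "u \<in> N" "deg u \<le> c u" "c' = topple \<Gamma> s u c"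
    using assms by (auto simp: toppling_def stable_vertex_def not_less)
  have "sum c' N = c' u + sum c' (N - {u})"
    using u(1) finite_N by (simp add: sum.remove)
  also have "c' u = c u - deg u"
    by (simp add: u topple_def)
  also have "sum c' (N - {u}) = (\<Sum>v\<in>N - {u}. c v + E u v)"
    by (rule sum.cong) (auto simp: u topple_def)
  also have "\<dots> = sum c (N - {u}) + sum (E u) (N - {u})"
    by (simp add: sum.distrib)
  also have "sum (E u) (N - {u}) = sum (E u) N"
    using u(1) finite_N by (simp add: sum.remove)
  finally have "sum c' N = c u - deg u + (sum c (N - {u}) + sum (E u) N)" .
  moreover have "sum c N = c u + sum c (N - {u})"
    using u(1) finite_N by (simp add: sum.remove)
  moreover have "sum (E u) N < deg u"
    using sink_adjacent[OF u(1)] by (simp add: deg_eq)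
  ultimately show ?thesis
    using u(2) by linarith
qed

text \<open>Toppling \<open>u\<close> never removes chips from \<open>v\<close>, so \<open>v\<close>
  stays unstable, and the two topplings commute.\<close>

lemma toppling_diamond:
  assumes "T c a" "T c b" "a \<noteq> b"
  shows "\<exists>d. T a d \<and> T b d"
proof -
  obtain u where u: "u \<in> N" "deg u \<le> c u" "a = topple \<Gamma> s u c"
    using assms(1) by (auto simp: toppling_def stable_vertex_def not_less)
  obtain v where v: "v \<in> N" "deg v \<le> c v" "b = topple \<Gamma> s v c"
    using assms(2) by (auto simp: toppling_def stable_vertex_def not_less)
  have "u \<noteq> v" using assms(3) u v by auto
  have "T a (topple \<Gamma> s v a)"
    using u v \<open>u \<noteq> v\<close> by (intro topplingI) (auto simp: topple_def)
  moreover have "T b (topple \<Gamma> s u b)"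
    using u v \<open>u \<noteq> v\<close> by (intro topplingI) (auto simp: topple_def)
  moreover have "topple \<Gamma> s v a = topple \<Gamma> s u b"
    using u v \<open>u \<noteq> v\<close> by (auto simp: topple_def fun_eq_iff)
  ultimately show ?thesis by metis
qed

lemma stable_no_toppling: "stable \<Gamma> s c \<Longrightarrow> \<not> T c c'"
  by (auto simp: stable_def toppling_def)

text \<open>Induction along the path to \<open>e\<close>: the diamond carries the alternative step
  one toppling further, and at the stable \<open>e\<close> no step exists.\<close>

lemma toppling_strip:
  assumes "T\<^sup>*\<^sup>* c e" "stable \<Gamma> s e" "T c a"
  shows "T\<^sup>*\<^sup>* a e"
  using assms
proof (induction arbitrary: a rule: converse_rtranclp_induct)
  case base
  then show ?case by (simp add: stable_no_toppling)
next
  case (step c b)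
  show ?case
  proof (cases "a = b")
    case True
    then show ?thesis using step by simp
  next
    case False
    then obtain d where "T a d" "T b d"
      using toppling_diamond step by blast
    then show ?thesis
      using step by (meson converse_rtranclp_into_rtranclp)
  qed
qed

lemma topplings_strip:
  assumes "T\<^sup>*\<^sup>* c a" "T\<^sup>*\<^sup>* c e" "stable \<Gamma> s e"
  shows "T\<^sup>*\<^sup>* a e"
  using assms by (induction rule: rtranclp_induct) (auto intro: toppling_strip)

lemma stabilization_exists: "\<exists>c'. T\<^sup>*\<^sup>* c c' \<and> stable \<Gamma> s c'"
proof (induction "sum c N" arbitrary: c rule: less_induct)
  case less
  show ?case
  proof (cases "stable \<Gamma> s c")
    case False
    then obtain u where "u \<in> N" "\<not> stable_vertex \<Gamma> c u"
      by (auto simp: stable_def)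
    then have "T c (topple \<Gamma> s u c)"
      by (auto simp: toppling_def)
    then show ?thesis
      using less[OF toppling_decreases] by (meson converse_rtranclp_into_rtranclp)
  qed blast
qed

text \<open>Confluence makes the definite description meaningful. From here on a stabilization is
  computed by exhibiting one toppling path to a stable configuration.\<close>

lemma stab_eqI:
  assumes "T\<^sup>*\<^sup>* c c'" "stable \<Gamma> s c'"
  shows "stab c = c'"
  unfolding stabilization_def
proof (rule the_equality)
  fix e assume e: "T\<^sup>*\<^sup>* c e \<and> stable \<Gamma> s e"
  then have "T\<^sup>*\<^sup>* e c'"
    using topplings_strip assms by blast
  then show "e = c'"
    using e stable_no_toppling by (metis converse_rtranclpE)
qed (use assms in simp)

lemma stab_reachable: "T\<^sup>*\<^sup>* c (stab c)"
  and stable_stab: "stable \<Gamma> s (stab c)"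
proof -
  obtain c' where "T\<^sup>*\<^sup>* c c'" "stable \<Gamma> s c'"
    using stabilization_exists by blast
  moreover from this have "stab c = c'"
    by (rule stab_eqI)
  ultimately show "T\<^sup>*\<^sup>* c (stab c)" "stable \<Gamma> s (stab c)"
    by simp_all
qed

lemma stab_stable: "stable \<Gamma> s c \<Longrightarrow> stab c = c"
  by (rule stab_eqI) simp_all

lemma stab_topplings:
  assumes "T\<^sup>*\<^sup>* c c'"
  shows "stab c = stab c'"
  using rtranclp_trans[OF assms stab_reachable] stable_stab by (rule stab_eqI)

text \<open>Extra chips keep a legal toppling legal. Hence a summand may be stabilized first, which
  later yields associativity.\<close>

lemma toppling_add_left: "T c c' \<Longrightarrow> T (\<lambda>v. c v + e v) (\<lambda>v. c' v + e v)"
proof -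
  assume "T c c'"
  then obtain u where "u \<in> N" "deg u \<le> c u" "c' = topple \<Gamma> s u c"
    by (auto simp: toppling_def stable_vertex_def not_less)
  moreover from this have "(\<lambda>v. c' v + e v) = topple \<Gamma> s u (\<lambda>v. c v + e v)"
    by (auto simp: topple_def)
  ultimately show "T (\<lambda>v. c v + e v) (\<lambda>v. c' v + e v)"
    using topplingI[of u "\<lambda>v. c v + e v"] by simp
qed

lemma topplings_add_left: "T\<^sup>*\<^sup>* c c' \<Longrightarrow> T\<^sup>*\<^sup>* (\<lambda>v. c v + e v) (\<lambda>v. c' v + e v)"
  by (induction rule: rtranclp_induct) (auto dest: toppling_add_left intro: rtranclp.rtrancl_into_rtrancl)

lemma topplings_add:
  assumes "T\<^sup>*\<^sup>* c c'" "T\<^sup>*\<^sup>* e e'"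
  shows "T\<^sup>*\<^sup>* (\<lambda>v. c v + e v) (\<lambda>v. c' v + e' v)"
proof -
  have "T\<^sup>*\<^sup>* (\<lambda>v. c v + e v) (\<lambda>v. c' v + e v)"
    using assms(1) by (rule topplings_add_left)
  also have "T\<^sup>*\<^sup>* (\<lambda>v. c' v + e v) (\<lambda>v. c' v + e' v)"
    using topplings_add_left[OF assms(2), of c'] by (simp add: add.commute)
  finally show ?thesis .
qed

lemma stab_add_left: "stab (\<lambda>v. stab c v + e v) = stab (\<lambda>v. c v + e v)"
  using stab_topplings[OF topplings_add_left[OF stab_reachable]] by metis

lemma stab_add_right: "stab (\<lambda>v. e v + stab c v) = stab (\<lambda>v. e v + c v)"
  using stab_add_left[of c e] by (simp add: add.commute)

lemma toppling_configuration: "T c c' \<Longrightarrow> c \<in> configurations \<Gamma> s \<Longrightarrow> c' \<in> configurations \<Gamma> s"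
  by (auto simp: configurations_def toppling_def topple_def)

lemma stab_configuration:
  assumes "c \<in> configurations \<Gamma> s"
  shows "stab c \<in> configurations \<Gamma> s"
proof -
  have "e \<in> configurations \<Gamma> s" if "T\<^sup>*\<^sup>* c e" for e
    using that by induction (use assms toppling_configuration in blast)+
  then show ?thesis
    using stab_reachable by blast
qed

section \<open>Congruence modulo the image of the Laplacian\<close>

definition lap_equiv :: "('v \<Rightarrow> int) \<Rightarrow> ('v \<Rightarrow> int) \<Rightarrow> bool" where
  "lap_equiv a b \<longleftrightarrow> (\<exists>x. \<forall>v\<in>N. a v - b v = lap x v)"

lemma lap_equiv_refl: "lap_equiv a a"
  unfolding lap_equiv_def by (rule exI[of _ "\<lambda>_. 0"]) (simp add: lap_def)

lemma lap_equiv_sym: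
  assumes "lap_equiv a b"
  shows "lap_equiv b a"
proof -
  obtain x where "\<forall>v\<in>N. a v - b v = lap x v"
    using assms by (auto simp: lap_equiv_def)
  then have "\<forall>v\<in>N. b v - a v = lap (\<lambda>w. 0 - x w) v"
    unfolding lap_diff lap_const by fastforce
  then show ?thesis
    unfolding lap_equiv_def by blast
qed

lemma lap_equiv_add:
  assumes "lap_equiv a b" "lap_equiv a' b'"
  shows "lap_equiv (\<lambda>v. a v + a' v) (\<lambda>v. b v + b' v)"
proof -
  obtain x y where "\<forall>v\<in>N. a v - b v = lap x v" "\<forall>v\<in>N. a' v - b' v = lap y v"
    using assms by (auto simp: lap_equiv_def)
  then have "\<forall>v\<in>N. (a v + a' v) - (b v + b' v) = lap (\<lambda>w. x w + y w) v"
    unfolding lap_add by fastforce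
  then show ?thesis
    unfolding lap_equiv_def by blast
qed

lemma lap_equiv_trans:
  assumes "lap_equiv a b" "lap_equiv b c"
  shows "lap_equiv a c"
proof -
  \<comment> \<open>The relation depends only on differences, and in this one \<open>b\<close>
    cancels.\<close>
  have "lap_equiv (\<lambda>v. a v + b v) (\<lambda>v. b v + c v)"
    using assms by (rule lap_equiv_add)
  then show ?thesis
    by (simp add: lap_equiv_def algebra_simps)
qed

lemma topplings_lap_equiv:
  assumes "T\<^sup>*\<^sup>* c c'"
  shows "lap_equiv (int \<circ> c) (int \<circ> c')"
  using assms
proof (induction rule: rtranclp_induct)
  case base
  show ?case by (rule lap_equiv_refl)
next
  case (step b c')
  from step(2) have "lap_equiv (int \<circ> b) (int \<circ> c')"
    by (rule toppling_lap) (auto simp: lap_equiv_def)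
  with step(3) show ?case by (rule lap_equiv_trans)
qed

lemma stab_lap_equiv: "lap_equiv (int \<circ> c) (int \<circ> stab c)"
  by (rule topplings_lap_equiv[OF stab_reachable])

text \<open>If the initial chips at each vertex pay for all its \<open>y v\<close> topplings, any
  order is legal, because chips received in between only help. Thus a whole vector can be fired at
  once.\<close>

lemma multi_topple:
  assumes "\<And>v. v \<in> N \<Longrightarrow> deg v * y v \<le> c v"
  obtains c' where "T\<^sup>*\<^sup>* c c'"
    "\<And>v. v \<in> N \<Longrightarrow> int (c' v) = int (c v) - lap (int \<circ> y) v"
    "\<And>v. v \<notin> N \<Longrightarrow> c' v = c v"
proof -
  have "\<exists>c'. T\<^sup>*\<^sup>* c c' \<and> (\<forall>v\<in>N. int (c' v) = int (c v) - lap (int \<circ> y) v) \<and> (\<forall>v. v \<notin> N \<longrightarrow> c' v = c v)"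
    using assms
  proof (induction "sum y N" arbitrary: y c)
    case 0
    then have "\<And>v. v \<in> N \<Longrightarrow> y v = 0"
      using finite_N by simp
    then have "\<forall>v\<in>N. lap (int \<circ> y) v = 0"
      by (simp add: lap_def)
    then show ?case by (intro exI[of _ c]) (simp del: o_apply)
  next
    case (Suc m)
    then obtain u where u: "u \<in> N" "y u > 0"
      by (metis gr0I nat.distinct(1) sum.neutral)
    define y' where "y' = y(u := y u - 1)"
    have y_eq: "y v = y' v + (if v = u then 1 else 0)" for v
      using u(2) by (simp add: y'_def)
    have "sum y N = sum y' N + 1"
      unfolding y_eq sum.distrib using u(1) finite_N by simp
    then have m: "m = sum y' N" using Suc.hyps(2) by simp
    have du: "deg u * y' u + deg u \<le> c u"
      using Suc.prems[OF u(1)] by (simp add: y_eq)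
    then have 1: "T c (topple \<Gamma> s u c)"
      by (intro topplingI u) simp
    have "deg v * y' v \<le> topple \<Gamma> s u c v" if "v \<in> N" for v
    proof (cases "v = u")
      case True
      then show ?thesis using du by (simp add: topple_def)
    next
      case False
      then show ?thesis using Suc.prems[OF that] that by (simp add: topple_def y_eq)
    qed
    from Suc.hyps(1)[OF m this] obtain c' where c': "T\<^sup>*\<^sup>* (topple \<Gamma> s u c) c'"
      "\<And>v. v \<in> N \<Longrightarrow> int (c' v) = int (topple \<Gamma> s u c v) - lap (int \<circ> y') v"
      "\<And>v. v \<notin> N \<Longrightarrow> c' v = topple \<Gamma> s u c v"
      by blast
    have y_int: "int \<circ> y = (\<lambda>v. (int \<circ> y') v + (if v = u then 1 else 0))"
      by (auto simp: y_eq)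
    have "int (c' v) = int (c v) - lap (int \<circ> y) v" if "v \<in> N" for v
      unfolding y_int lap_add lap_unit[OF u(1)] c'(2)[OF that]
      using du that by (auto simp: topple_def comp_def)
    moreover have "c' v = c v" if "v \<notin> N" for v
      using c'(3)[OF that] that u(1) by (auto simp: topple_def)
    ultimately show ?case
      using 1 c'(1) by (meson converse_rtranclp_into_rtranclp)
  qed
  with that show thesis by blast
qed

section \<open>Firing the sink and recurrence\<close>

lemma lap_ones: "lap (int \<circ> (\<lambda>_. m)) v = int (m * E s v)"
  using lap_const[of "int m" v] by (simp add: comp_def)

text \<open>Toppling every vertex once undoes the firing of the sink.\<close>

lemma stab_fire_sink:
  assumes "\<And>v. v \<in> N \<Longrightarrow> deg v \<le> c v + E s v"
  shows "stab (\<lambda>v. c v + E s v) = stab c"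
proof -
  obtain c' where c': "T\<^sup>*\<^sup>* (\<lambda>v. c v + E s v) c'"
    "\<And>v. v \<in> N \<Longrightarrow> int (c' v) = int (c v + E s v) - lap (int \<circ> (\<lambda>_. 1)) v"
    "\<And>v. v \<notin> N \<Longrightarrow> c' v = c v + E s v"
    using multi_topple[of "\<lambda>_. 1" "\<lambda>v. c v + E s v"] assms by (auto simp del: o_apply)
  have "c' v = c v" for v
  proof (cases "v \<in> N")
    case True
    then show ?thesis using c'(2)[OF True] unfolding lap_ones by simp
  next
    case False
    then show ?thesis using c'(3) E_sink_outside by simp
  qed
  then have "c' = c" by auto
  then show ?thesis using stab_topplings[OF c'(1)] by simp
qed

lemma sink_configuration: "E s \<in> configurations \<Gamma> s"
  by (auto simp: configurations_def E_sink_outside)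

lemma configurations_add:
  "a \<in> configurations \<Gamma> s \<Longrightarrow> b \<in> configurations \<Gamma> s \<Longrightarrow> (\<lambda>v. a v + b v) \<in> configurations \<Gamma> s"
  by (simp add: configurations_def)

text \<open>The only place where connectivity is used: the set of vertices on which copies of \<open>r\<close> can pile
  up arbitrarily high is closed under adjacency.\<close>

lemma spread_vertex:
  assumes "r \<in> configurations \<Gamma> s" "r \<noteq> (\<lambda>_. 0)" "v \<in> N"
  shows "\<exists>j e. T\<^sup>*\<^sup>* (\<lambda>w. j * r w) e \<and> m \<le> e v"
proof -
  define S where "S = {v \<in> N. \<forall>m. \<exists>j e. T\<^sup>*\<^sup>* (\<lambda>w. j * r w) e \<and> m \<le> e v}"
  obtain v0 where v0: "r v0 \<noteq> 0" "v0 \<in> N"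
    using assms(1,2) unfolding configurations_def fun_eq_iff by blast
  have "\<exists>j e. T\<^sup>*\<^sup>* (\<lambda>w. j * r w) e \<and> m \<le> e v0" for m
    using v0(1) by (intro exI[of _ m] exI[of _ "\<lambda>w. m * r w"]) simp
  then have "v0 \<in> S"
    using v0(2) by (simp add: S_def)
  moreover have "v \<in> S" if u: "u \<in> S" and v: "v \<in> N" and uv: "E u v > 0" for u v
  proof -
    have "\<exists>j e. T\<^sup>*\<^sup>* (\<lambda>w. j * r w) e \<and> m \<le> e v" for m
    proof -
      \<comment> \<open>Enough chips for \<open>m\<close> topplings of \<open>u\<close>, each of
        which sends at least one chip to \<open>v\<close>.\<close>
      obtain j e where e: "T\<^sup>*\<^sup>* (\<lambda>w. j * r w) e" "deg u * m \<le> e u"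
        using u unfolding S_def by blast
      have uN: "u \<in> N" using u by (simp add: S_def)
      have "deg w * (if w = u then m else 0) \<le> e w" for w
        using e(2) by simp
      then obtain e' where e': "T\<^sup>*\<^sup>* e e'"
        "\<And>w. w \<in> N \<Longrightarrow> int (e' w) = int (e w) - lap (int \<circ> (\<lambda>w. if w = u then m else 0)) w"
        using multi_topple[of "\<lambda>w. if w = u then m else 0" e] by metis
      have "int \<circ> (\<lambda>w. if w = u then m else 0) = (\<lambda>w. int m * (if w = u then 1 else 0))"
        by auto
      then have "int (e' v) = int (e v) + int m * int (E u v)"
        using e'(2)[OF v] uv unfolding lap_scale lap_unit[OF uN]
        by (cases "v = u") (simp_all add: lap_scale lap_unit[OF uN])
      then have "e' v = e v + m * E u v"
        by (metis of_nat_add of_nat_eq_iff of_nat_mult)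
      then have "m \<le> e' v"
        using uv by (simp add: trans_le_add2)
      moreover have "T\<^sup>*\<^sup>* (\<lambda>w. j * r w) e'"
        using e(1) e'(1) by (rule rtranclp_trans)
      ultimately show ?thesis by blast
    qed
    then show ?thesis using v by (simp add: S_def)
  qed
  ultimately have "S = N"
    by (intro nonsink_connected) (auto simp: S_def)
  then show ?thesis
    using assms(3) by (auto simp: S_def)
qed

text \<open>The piles obtained for single vertices are added up, at the price of more copies of
  \<open>r\<close>.\<close>

lemma spread:
  assumes r: "r \<in> configurations \<Gamma> s" "r \<noteq> (\<lambda>_. 0)"
  shows "\<exists>j e. T\<^sup>*\<^sup>* (\<lambda>w. j * r w) e \<and> (\<forall>v\<in>N. f v \<le> e v)"
proof -
  have "\<exists>j e. T\<^sup>*\<^sup>* (\<lambda>w. j * r w) e \<and> (\<forall>v\<in>A. f v \<le> e v)" if "finite A" "A \<subseteq> N" for A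
    using that
  proof (induction A rule: finite_induct)
    case (insert u A)
    then obtain j e where e: "T\<^sup>*\<^sup>* (\<lambda>w. j * r w) e" "\<forall>v\<in>A. f v \<le> e v"
      by blast
    obtain j' e' where e': "T\<^sup>*\<^sup>* (\<lambda>w. j' * r w) e'" "f u \<le> e' u"
      using spread_vertex[OF r] insert.prems by blast
    have "T\<^sup>*\<^sup>* (\<lambda>w. (j + j') * r w) (\<lambda>w. e w + e' w)"
      using topplings_add[OF e(1) e'(1)] by (simp add: algebra_simps)
    moreover have "\<forall>v\<in>insert u A. f v \<le> e v + e' v"
      using e(2) e'(2) by (auto intro: trans_le_add1 trans_le_add2)
    ultimately show ?case by blast
  qed blast
  then show ?thesis using finite_N by blast
qed

text \<open>The burning test. Adding \<open>r\<close> repeatedly shows that \<open>c\<close> is the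
  stabilization of some \<open>R\<close> with at least \<open>deg v\<close> chips at each
  \<open>v\<close>, and there firing the sink is undone by toppling every vertex once. Conversely,
  the sink vector \<open>E s\<close> is itself a suitable non-zero \<open>r\<close>.\<close>

lemma recurrent_iff:
  "recurrent \<Gamma> s c \<longleftrightarrow>
     c \<in> configurations \<Gamma> s \<and> stable \<Gamma> s c \<and> stab (\<lambda>v. c v + E s v) = c"
proof
  assume "recurrent \<Gamma> s c"
  then obtain r where c: "c \<in> configurations \<Gamma> s" "stable \<Gamma> s c"
    and r: "r \<in> configurations \<Gamma> s" "r \<noteq> (\<lambda>_. 0)" "stab (\<lambda>v. c v + r v) = c"
    unfolding recurrent_def by blast
  have many: "stab (\<lambda>v. c v + j * r v) = c" for j
  proof (induction j)
    case 0
    show ?case using c(2) by (simp add: stab_stable)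
  next
    case (Suc j)
    have "stab (\<lambda>v. c v + Suc j * r v) = stab (\<lambda>v. (c v + r v) + j * r v)"
      by (simp add: algebra_simps)
    also have "\<dots> = stab (\<lambda>v. c v + j * r v)"
      using stab_add_left[of "\<lambda>v. c v + r v" "\<lambda>v. j * r v"] r(3) by simp
    finally show ?case using Suc by simp
  qed
  obtain j e where e: "T\<^sup>*\<^sup>* (\<lambda>w. j * r w) e" "\<forall>v\<in>N. deg v \<le> e v"
    using spread[OF r(1,2)] by blast
  define R where "R = (\<lambda>v. e v + c v)"
  have "T\<^sup>*\<^sup>* (\<lambda>v. j * r v + c v) R"
    using topplings_add_left[OF e(1)] by (simp add: R_def)
  then have R: "stab R = c"
    using many[of j] stab_topplings by (metis (no_types, lifting) add.commute ext)
  have "stab (\<lambda>v. R v + E s v) = stab R"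
    using e(2) by (intro stab_fire_sink) (simp add: R_def trans_le_add1)
  then have "stab (\<lambda>v. c v + E s v) = c"
    using stab_add_left[of R "E s"] R by simp
  with c show "c \<in> configurations \<Gamma> s \<and> stable \<Gamma> s c \<and> stab (\<lambda>v. c v + E s v) = c"
    by blast
next
  assume c: "c \<in> configurations \<Gamma> s \<and> stable \<Gamma> s c \<and> stab (\<lambda>v. c v + E s v) = c"
  obtain v where "v \<in> N" using nonsink_nonempty by blast
  then have "E s v \<noteq> 0" using sink_adjacent by fastforce
  then have "E s \<noteq> (\<lambda>_. 0)" by (auto simp: fun_eq_iff)
  then show "recurrent \<Gamma> s c"
    unfolding recurrent_def using c sink_configuration by blast
qed

section \<open>Exactly one recurrent configuration in each class\<close>

lemma recurrent_stab_sink: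
  assumes "recurrent \<Gamma> s c"
  shows "stab (\<lambda>v. c v + m * E s v) = c"
proof (induction m)
  case 0
  show ?case using assms by (simp add: stab_stable recurrent_def)
next
  case (Suc m)
  have "stab (\<lambda>v. c v + Suc m * E s v) = stab (\<lambda>v. (c v + E s v) + m * E s v)"
    by (simp add: algebra_simps)
  also have "\<dots> = stab (\<lambda>v. c v + m * E s v)"
    using stab_add_left[of "\<lambda>v. c v + E s v" "\<lambda>v. m * E s v"] assms by (simp add: recurrent_iff)
  finally show ?case using Suc by simp
qed

text \<open>The burning test survives adding \<open>b\<close>, since \<open>a\<close> can absorb the
  sink vector before \<open>b\<close> is added.\<close>

lemma recurrent_stab_add:
  assumes "recurrent \<Gamma> s a" "b \<in> configurations \<Gamma> s"
  shows "recurrent \<Gamma> s (stab (\<lambda>v. a v + b v))"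
proof -
  have "stab (\<lambda>v. stab (\<lambda>v. a v + b v) v + E s v) = stab (\<lambda>v. (a v + E s v) + b v)"
    using stab_add_left[of "\<lambda>v. a v + b v" "E s"] by (simp add: algebra_simps)
  also have "\<dots> = stab (\<lambda>v. a v + b v)"
    using stab_add_left[of "\<lambda>v. a v + E s v" b] assms by (simp add: recurrent_iff)
  finally show ?thesis
    using assms by (simp add: recurrent_iff stable_stab stab_configuration configurations_add)
qed

text \<open>Firing the sink \<open>m\<close> times leaves both stabilizations unchanged and supplies
  the chips to topple \<open>a\<close> by the positive part and \<open>b\<close> by the negative
  part of \<open>x\<close>. Both then reach the same configuration.\<close>

lemma recurrent_unique:
  assumes a: "recurrent \<Gamma> s a" and b: "recurrent \<Gamma> s b"
    and equiv: "lap_equiv (int \<circ> a) (int \<circ> b)"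
  shows "a = b"
proof -
  obtain x where x: "\<And>v. v \<in> N \<Longrightarrow> int (a v) - int (b v) = lap x v"
    using equiv by (auto simp: lap_equiv_def)
  define p q where "p = (\<lambda>v. nat (x v))" and "q = (\<lambda>v. nat (- x v))"
  have x_eq: "x = (\<lambda>v. (int \<circ> p) v - (int \<circ> q) v)"
    by (auto simp: p_def q_def)
  \<comment> \<open>One crude bound for all vertices; as \<open>E s v\<close> is at least 1,
    \<open>m\<close> firings of the sink provide it everywhere.\<close>
  define m where "m = (\<Sum>v\<in>N. deg v * (p v + q v))"
  have m: "deg v * (p v + q v) \<le> m * E s v" if "v \<in> N" for v
  proof -
    have "deg v * (p v + q v) \<le> m"
      unfolding m_def using finite_N that
      by (intro member_le_sum[where f = "\<lambda>v. deg v * (p v + q v)"]) auto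
    also have "\<dots> \<le> m * E s v"
      using sink_adjacent[OF that] by simp
    finally show ?thesis .
  qed
  have p: "deg v * p v \<le> a v + m * E s v" if "v \<in> N" for v
    using m[OF that] by (simp add: algebra_simps)
  have q: "deg v * q v \<le> b v + m * E s v" if "v \<in> N" for v
    using m[OF that] by (simp add: algebra_simps)
  obtain a' where a': "T\<^sup>*\<^sup>* (\<lambda>v. a v + m * E s v) a'"
    "\<And>v. v \<in> N \<Longrightarrow> int (a' v) = int (a v + m * E s v) - lap (int \<circ> p) v"
    "\<And>v. v \<notin> N \<Longrightarrow> a' v = a v + m * E s v"
    using multi_topple[OF p] by blast
  obtain b' where b': "T\<^sup>*\<^sup>* (\<lambda>v. b v + m * E s v) b'"
    "\<And>v. v \<in> N \<Longrightarrow> int (b' v) = int (b v + m * E s v) - lap (int \<circ> q) v"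
    "\<And>v. v \<notin> N \<Longrightarrow> b' v = b v + m * E s v"
    using multi_topple[OF q] by blast
  have "a' v = b' v" for v
  proof (cases "v \<in> N")
    case True
    have "lap x v = lap (int \<circ> p) v - lap (int \<circ> q) v"
      by (subst x_eq) (rule lap_diff)
    then have "int (a' v) = int (b' v)"
      using x[OF True] a'(2)[OF True] b'(2)[OF True] by simp
    then show ?thesis by simp
  next
    case False
    then show ?thesis
      using a b a'(3) b'(3) by (simp add: recurrent_def configurations_def)
  qed
  then have "stab (\<lambda>v. a v + m * E s v) = stab (\<lambda>v. b v + m * E s v)"
    using stab_topplings[OF a'(1)] stab_topplings[OF b'(1)] by presburger
  then show ?thesis
    using recurrent_stab_sink a b by metis
qed

text \<open>On \<open>N\<close> the sink vector is the Laplacian of the constant 1, so adding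
  \<open>m\<close> copies of it stays in the class of \<open>z\<close>. For large \<open>m\<close>
  all entries reach the degrees, and the stabilization passes the burning test.\<close>

lemma recurrent_exists:
  obtains c where "recurrent \<Gamma> s c" "lap_equiv (int \<circ> c) z"
proof -
  define m where "m = (\<Sum>v\<in>N. deg v + nat \<bar>z v\<bar>)"
  define R where "R v = (if v \<in> N then nat (z v + int m * int (E s v)) else 0)" for v
  have R: "int (R v) = z v + int m * int (E s v)" "deg v \<le> R v" if "v \<in> N" for v
  proof -
    have "deg v + nat \<bar>z v\<bar> \<le> m"
      unfolding m_def using finite_N that
      by (intro member_le_sum[where f = "\<lambda>v. deg v + nat \<bar>z v\<bar>"]) auto
    also have "\<dots> \<le> m * E s v"
      using sink_adjacent[OF that] by simp
    finally have "int (deg v) + \<bar>z v\<bar> \<le> int m * int (E s v)"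
      by (metis int_nat_eq of_nat_add of_nat_le_iff of_nat_mult abs_ge_zero)
    then show "int (R v) = z v + int m * int (E s v)" "deg v \<le> R v"
      using that by (auto simp: R_def)
  qed
  have R_conf: "R \<in> configurations \<Gamma> s"
    by (simp add: configurations_def R_def)
  have "stab (\<lambda>v. stab R v + E s v) = stab (\<lambda>v. R v + E s v)"
    by (rule stab_add_left)
  also have "\<dots> = stab R"
    using R(2) by (intro stab_fire_sink) (simp add: trans_le_add1)
  finally have "recurrent \<Gamma> s (stab R)"
    by (simp add: recurrent_iff stable_stab stab_configuration R_conf)
  moreover have "lap_equiv (int \<circ> R) z"
    unfolding lap_equiv_def
    by (rule exI[of _ "\<lambda>_. int m"]) (simp add: lap_const R(1))
  then have "lap_equiv (int \<circ> stab R) z"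
    using stab_lap_equiv lap_equiv_sym lap_equiv_trans by blast
  ultimately show thesis by (rule that)
qed

section \<open>The sandpile group\<close>

abbreviation SP :: "('v \<Rightarrow> nat) monoid" where "SP \<equiv> sandpile_group \<Gamma> s"

lemma carrier_SP: "c \<in> carrier SP \<longleftrightarrow> recurrent \<Gamma> s c"
  by (simp add: sandpile_group_def)

lemma mult_SP: "a \<otimes>\<^bsub>SP\<^esub> b = stab (\<lambda>v. a v + b v)"
  by (simp add: sandpile_group_def)

lemma mult_SP_lap_equiv: "lap_equiv (int \<circ> (a \<otimes>\<^bsub>SP\<^esub> b)) (\<lambda>v. int (a v) + int (b v))"
proof -
  have "lap_equiv (int \<circ> (\<lambda>v. a v + b v)) (int \<circ> (a \<otimes>\<^bsub>SP\<^esub> b))"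
    unfolding mult_SP by (rule stab_lap_equiv)
  then show ?thesis
    by (simp add: lap_equiv_sym comp_def)
qed

text \<open>Uniqueness within a class turns an equivalence into an equality; the neutral element is
  therefore the recurrent configuration in the class of 0.\<close>

lemma mult_zero_class:
  assumes "recurrent \<Gamma> s e" "lap_equiv (int \<circ> e) (\<lambda>_. 0)" "recurrent \<Gamma> s c"
  shows "e \<otimes>\<^bsub>SP\<^esub> c = c"
proof (rule recurrent_unique)
  show "recurrent \<Gamma> s (e \<otimes>\<^bsub>SP\<^esub> c)"
    unfolding mult_SP using assms by (intro recurrent_stab_add) (simp_all add: recurrent_def)
  have "lap_equiv (\<lambda>v. (int \<circ> e) v + (int \<circ> c) v) (\<lambda>v. 0 + (int \<circ> c) v)"
    by (intro lap_equiv_add assms lap_equiv_refl)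
  then show "lap_equiv (int \<circ> (e \<otimes>\<^bsub>SP\<^esub> c)) (int \<circ> c)"
    using lap_equiv_trans[OF mult_SP_lap_equiv[of e c]] by (simp add: comp_def)
qed (rule assms)

lemma comm_mult_SP: "a \<otimes>\<^bsub>SP\<^esub> b = b \<otimes>\<^bsub>SP\<^esub> a"
  by (simp add: mult_SP add.commute)

lemma one_SP:
  assumes "recurrent \<Gamma> s e" "lap_equiv (int \<circ> e) (\<lambda>_. 0)"
  shows "\<one>\<^bsub>SP\<^esub> = e"
proof -
  have "\<one>\<^bsub>SP\<^esub> = (THE e. recurrent \<Gamma> s e \<and> (\<forall>c. recurrent \<Gamma> s c \<longrightarrow> e \<otimes>\<^bsub>SP\<^esub> c = c \<and> c \<otimes>\<^bsub>SP\<^esub> e = c))"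
    by (simp add: sandpile_group_def)
  also have "\<dots> = e"
    by (rule the_equality) (use assms mult_zero_class comm_mult_SP in metis)+
  finally show ?thesis .
qed

lemma comm_group_SP: "comm_group SP"
proof (rule comm_groupI)
  obtain e where e: "recurrent \<Gamma> s e" "lap_equiv (int \<circ> e) (\<lambda>_. 0)"
    by (rule recurrent_exists)
  show "\<one>\<^bsub>SP\<^esub> \<in> carrier SP"
    using e by (simp add: one_SP carrier_SP)
  fix x assume x: "x \<in> carrier SP"
  then show "\<one>\<^bsub>SP\<^esub> \<otimes>\<^bsub>SP\<^esub> x = x"
    using e by (simp add: one_SP mult_zero_class carrier_SP)
  \<comment> \<open>The inverse of \<open>x\<close> is the recurrent representative of the class of
    \<open>- x\<close>.\<close>
  obtain y where y: "recurrent \<Gamma> s y" "lap_equiv (int \<circ> y) (\<lambda>v. - int (x v))"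
    by (rule recurrent_exists)
  have "lap_equiv (\<lambda>v. (int \<circ> y) v + int (x v)) (\<lambda>v. - int (x v) + int (x v))"
    by (intro lap_equiv_add y lap_equiv_refl)
  then have "lap_equiv (int \<circ> (y \<otimes>\<^bsub>SP\<^esub> x)) (\<lambda>_. 0)"
    using lap_equiv_trans[OF mult_SP_lap_equiv[of y x]] by simp
  moreover have "recurrent \<Gamma> s (y \<otimes>\<^bsub>SP\<^esub> x)"
    unfolding mult_SP using x y(1) by (intro recurrent_stab_add) (simp_all add: recurrent_def carrier_SP)
  ultimately show "\<exists>y\<in>carrier SP. y \<otimes>\<^bsub>SP\<^esub> x = \<one>\<^bsub>SP\<^esub>"
    using y(1) one_SP carrier_SP by metis
next
  fix x y assume "x \<in> carrier SP" "y \<in> carrier SP"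
  then show "x \<otimes>\<^bsub>SP\<^esub> y \<in> carrier SP"
    unfolding mult_SP by (auto simp: carrier_SP recurrent_def[of _ _ y] intro!: recurrent_stab_add)
next
  fix x y z
  show "x \<otimes>\<^bsub>SP\<^esub> y \<otimes>\<^bsub>SP\<^esub> z = x \<otimes>\<^bsub>SP\<^esub> (y \<otimes>\<^bsub>SP\<^esub> z)"
    by (simp add: mult_SP stab_add_left stab_add_right add.assoc)
qed (rule comm_mult_SP)

end


section \<open>Characters of the cube\<close>

definition flip :: "nat \<Rightarrow> nat list \<Rightarrow> nat list" where
  "flip i a = a[i := 1 - a ! i]"

lemma finite_bit_vectors: "finite (bit_vectors d)"
  using multigraph_hypercube[of d] by (simp add: multigraph_def hypercube_def)

lemma bit_vectors_length: "a \<in> bit_vectors d \<Longrightarrow> length a = d"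
  by (simp add: bit_vectors_def)

lemma bit_vectors_nth: "a \<in> bit_vectors d \<Longrightarrow> i < d \<Longrightarrow> a ! i = 0 \<or> a ! i = 1"
  using nth_mem[of i a] unfolding bit_vectors_def by blast

lemma card_bit_vectors: "card (bit_vectors d) = 2 ^ d"
proof -
  have "bit_vectors d = {a. set a \<subseteq> {0, 1} \<and> length a = d}"
    by (auto simp: bit_vectors_def)
  then show ?thesis by (simp add: card_lists_length_eq numeral_2_eq_2)
qed

lemma bit_vectors_Suc: "bit_vectors (Suc d) = Cons 0 ` bit_vectors d \<union> Cons 1 ` bit_vectors d"
proof -
  have "a \<in> Cons 0 ` bit_vectors d \<union> Cons 1 ` bit_vectors d" if "a \<in> bit_vectors (Suc d)" for a
    using that by (cases a) (auto simp: bit_vectors_def)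
  then show ?thesis by (auto simp: bit_vectors_def)
qed

text \<open>Splitting by the first bit gives Pascal's recursion.\<close>

lemma card_bit_vectors_weight: "card {b \<in> bit_vectors d. sum_list b = i} = d choose i"
proof (induction d arbitrary: i)
  case 0
  have *: "{b \<in> bit_vectors 0. sum_list b = i} = (if i = 0 then {[]} else {})"
    by (auto simp: bit_vectors_def)
  show ?case unfolding * by (cases i) simp_all
next
  case (Suc d)
  let ?W = "\<lambda>i. {b \<in> bit_vectors d. sum_list b = i}"
  have fin: "finite (?W i)" for i by (simp add: finite_bit_vectors)
  show ?case
  proof (cases i)
    case 0
    have "{b \<in> bit_vectors (Suc d). sum_list b = i} = Cons 0 ` ?W 0"
      unfolding bit_vectors_Suc 0 by auto
    then show ?thesis using Suc[of 0] 0 by (simp add: card_image)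
  next
    case (Suc j)
    have "{b \<in> bit_vectors (Suc d). sum_list b = i} = Cons 0 ` ?W (Suc j) \<union> Cons 1 ` ?W j"
      unfolding bit_vectors_Suc Suc by auto
    moreover have "card (Cons 0 ` ?W (Suc j) \<union> Cons 1 ` ?W j) = card (?W (Suc j)) + card (?W j)"
      by (subst card_Un_disjoint) (auto simp: fin card_image)
    ultimately show ?thesis using Suc.IH Suc by simp
  qed
qed

lemma sum_list_bits: "b \<in> bit_vectors d \<Longrightarrow> sum_list b = (\<Sum>i<d. b ! i)"
  by (simp add: sum_list_sum_nth bit_vectors_length atLeast0LessThan)

lemma sum_list_bits_le: "b \<in> bit_vectors d \<Longrightarrow> sum_list b \<le> d"
  using sum_bounded_above[of "{..<d}" "(!) b" 1] bit_vectors_nth[of b d]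
  by (fastforce simp: sum_list_bits)

lemma length_flip [simp]: "length (flip i a) = length a"
  by (simp add: flip_def)

lemma flip_nth: "i < length a \<Longrightarrow> flip i a ! j = (if j = i then 1 - a ! i else a ! j)"
  by (auto simp: flip_def)

lemma flip_bit_vectors: "a \<in> bit_vectors d \<Longrightarrow> flip i a \<in> bit_vectors d"
  by (auto simp: bit_vectors_def flip_def dest!: set_update_subset_insert[THEN subsetD])

lemma flip_flip: "a \<in> bit_vectors d \<Longrightarrow> i < d \<Longrightarrow> flip i (flip i a) = a"
  using bit_vectors_nth[of a d i] bit_vectors_length[of a d]
  by (auto simp: flip_def list_update_same_conv)

lemma flip_commute: "flip i (flip j a) = flip j (flip i a)"
  by (cases "i = j") (auto simp: flip_def list_update_swap)

lemma flip_bij_betw: "i < d \<Longrightarrow> bij_betw (flip i) (bit_vectors d) (bit_vectors d)"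
  by (rule bij_betw_byWitness[where f' = "flip i"]) (auto simp: flip_flip flip_bit_vectors)

lemma sum_flip: "i < d \<Longrightarrow> (\<Sum>a\<in>bit_vectors d. f (flip i a)) = (\<Sum>a\<in>bit_vectors d. f a)"
  by (rule sum.reindex_bij_betw[OF flip_bij_betw])

text \<open>Only the \<open>i\<close>-th summand of the dot product changes, up or down by
  \<open>b ! i\<close>.\<close>

lemma even_dot_flip:
  assumes a: "a \<in> bit_vectors d" and b: "b \<in> bit_vectors d" and i: "i < d"
  shows "even (dot b (flip i a)) \<longleftrightarrow> (even (dot b a) \<longleftrightarrow> b ! i = 0)"
proof -
  have len: "length a = d" "length b = d" using a b by (simp_all add: bit_vectors_length)
  have split: "dot b c = b ! i * c ! i + (\<Sum>j\<in>{..<d} - {i}. b ! j * c ! j)" for c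
    using i len by (simp add: dot_def sum.remove)
  have "(\<Sum>j\<in>{..<d} - {i}. b ! j * flip i a ! j) = (\<Sum>j\<in>{..<d} - {i}. b ! j * a ! j)"
    by (rule sum.cong) (auto simp: flip_nth i len)
  then show ?thesis
    using bit_vectors_nth[OF a i] bit_vectors_nth[OF b i] i len
    by (auto simp: split[of a] split[of "flip i a"] flip_nth)
qed

section \<open>Characters and their orthogonality\<close>

definition chi :: "nat list \<Rightarrow> nat list \<Rightarrow> int" where
  "chi b a = (if even (dot b a) then 1 else -1)"

lemma chi_flip:
  "\<lbrakk>a \<in> bit_vectors d; b \<in> bit_vectors d; i < d\<rbrakk> \<Longrightarrow> chi b (flip i a) = (1 - 2 * int (b ! i)) * chi b a"
  using even_dot_flip[of a d b i] bit_vectors_nth[of b d i] by (auto simp: chi_def)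

lemma chi_commute: "length a = length b \<Longrightarrow> chi a b = chi b a"
  by (simp add: chi_def dot_def mult.commute)

text \<open>Among the \<open>d\<close> neighbours, as many have the opposite sign as
  \<open>b\<close> has ones: \<open>chi b\<close> is an eigenvector of the adjacency matrix.\<close>

lemma sum_chi_flip:
  assumes "a \<in> bit_vectors d" "b \<in> bit_vectors d"
  shows "(\<Sum>i<d. chi b (flip i a)) = (int d - 2 * int (sum_list b)) * chi b a"
proof -
  have "(\<Sum>i<d. chi b (flip i a)) = (\<Sum>i<d. (1 - 2 * int (b ! i)) * chi b a)"
    using assms by (intro sum.cong) (auto simp: chi_flip)
  also have "\<dots> = (\<Sum>i<d. 1 - 2 * int (b ! i)) * chi b a"
    by (simp add: sum_distrib_right)
  also have "(\<Sum>i<d. 1 - 2 * int (b ! i)) = int d - 2 * int (sum_list b)"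
    using assms(2) by (simp add: sum_list_bits sum_subtractf sum_distrib_left)
  finally show ?thesis .
qed

text \<open>Flipping a coordinate in which \<open>b\<close> and \<open>g\<close> differ negates
  every summand, so the sum is its own negative.\<close>

lemma chi_orthogonal:
  assumes b: "b \<in> bit_vectors d" and g: "g \<in> bit_vectors d"
  shows "(\<Sum>a\<in>bit_vectors d. chi b a * chi g a) = (if b = g then 2 ^ d else 0)"
proof (cases "b = g")
  case True
  have "chi g a * chi g a = 1" for a by (simp add: chi_def)
  then show ?thesis by (simp add: True card_bit_vectors)
next
  case False
  then obtain i where i: "i < d" "b ! i \<noteq> g ! i"
    using b g by (metis bit_vectors_length nth_equalityI)
  let ?S = "\<Sum>a\<in>bit_vectors d. chi b a * chi g a"
  have "?S = (\<Sum>a\<in>bit_vectors d. chi b (flip i a) * chi g (flip i a))"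
    using i(1) by (rule sum_flip[symmetric])
  also have "\<dots> = (\<Sum>a\<in>bit_vectors d. - (chi b a * chi g a))"
    using i bit_vectors_nth[OF b i(1)] bit_vectors_nth[OF g i(1)]
    by (intro sum.cong) (auto simp: chi_flip[OF _ b] chi_flip[OF _ g])
  also have "\<dots> = - ?S" by (simp add: sum_negf)
  finally show ?thesis using False by simp
qed

lemma chi_zero: "chi (replicate d 0) a = 1"
  by (simp add: chi_def dot_def)

lemma zero_bit_vectors: "replicate d 0 \<in> bit_vectors d"
  by (auto simp: bit_vectors_def)

lemma sum_chi:
  assumes b: "b \<in> bit_vectors d" and pos: "sum_list b \<noteq> 0"
  shows "(\<Sum>a\<in>bit_vectors d. chi b a) = 0"
proof -
  have "b \<noteq> replicate d 0" using pos by auto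
  then show ?thesis
    using chi_orthogonal[OF b zero_bit_vectors] by (simp add: chi_zero)
qed

lemma chi_orthogonal':
  assumes "a \<in> bit_vectors d" "a' \<in> bit_vectors d"
  shows "(\<Sum>b\<in>bit_vectors d. chi b a * chi b a') = (if a = a' then 2 ^ d else 0)"
proof -
  have "(\<Sum>b\<in>bit_vectors d. chi b a * chi b a') = (\<Sum>b\<in>bit_vectors d. chi a b * chi a' b)"
    using assms by (intro sum.cong) (auto simp: bit_vectors_length intro!: arg_cong2[where f = "(*)"] chi_commute)
  then show ?thesis using chi_orthogonal[OF assms] by simp
qed

section \<open>Adjacency and connectivity of the cube\<close>

lemma nedges_hypercube:
  "nedges (hypercube d) a b = of_bool (a \<in> bit_vectors d \<and> b \<in> bit_vectors d
     \<and> card {i. i < d \<and> a ! i \<noteq> b ! i} = 1)"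
  by (simp only: hypercube_def mgraph.simps of_bool_def)

lemma hypercube_neighbours:
  assumes a: "a \<in> bit_vectors d"
  shows "{b \<in> bit_vectors d. nedges (hypercube d) a b = 1} = (\<lambda>i. flip i a) ` {..<d}"
proof (intro equalityI subsetI)
  fix b assume "b \<in> {b \<in> bit_vectors d. nedges (hypercube d) a b = 1}"
  then have b: "b \<in> bit_vectors d" and "nedges (hypercube d) a b = 1"
    by blast+
  then have "card {i. i < d \<and> a ! i \<noteq> b ! i} = 1"
    unfolding nedges_hypercube of_bool_eq_1_iff by blast
  then obtain i where i: "{i. i < d \<and> a ! i \<noteq> b ! i} = {i}"
    unfolding card_1_singleton_iff One_nat_def by blast
  then have "i < d" and differ: "\<And>j. j < d \<Longrightarrow> a ! j \<noteq> b ! j \<longleftrightarrow> j = i"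
    by blast+
  have "b = flip i a"
  proof (rule nth_equalityI)
    fix j assume "j < length b"
    then have "j < d" using b by (simp add: bit_vectors_length)
    then show "b ! j = flip i a ! j"
      using differ[OF \<open>j < d\<close>] \<open>i < d\<close> bit_vectors_nth[OF a, of j] bit_vectors_nth[OF b, of j]
      by (auto simp: flip_nth bit_vectors_length[OF a])
  qed (use a b in \<open>simp add: bit_vectors_length\<close>)
  then show "b \<in> (\<lambda>i. flip i a) ` {..<d}" using \<open>i < d\<close> by blast
next
  fix b assume "b \<in> (\<lambda>i. flip i a) ` {..<d}"
  then obtain i where i: "i < d" "b = flip i a" by blast
  have "{j. j < d \<and> a ! j \<noteq> b ! j} = {i}"
    using i a bit_vectors_nth[OF a i(1)] by (auto simp: flip_nth bit_vectors_length split: if_splits)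
  then show "b \<in> {b \<in> bit_vectors d. nedges (hypercube d) a b = 1}"
    using a i by (simp add: nedges_hypercube flip_bit_vectors)
qed

lemma flip_inj_index:
  assumes a: "a \<in> bit_vectors d"
  shows "inj_on (\<lambda>i. flip i a) {..<d}"
proof (rule inj_onI)
  fix i j assume "i \<in> {..<d}" "j \<in> {..<d}" "flip i a = flip j a"
  then have "flip i a ! i = flip j a ! i" "i < length a" "j < length a"
    using a by (simp_all add: bit_vectors_length)
  then show "i = j"
    using a bit_vectors_nth[OF a, of i] by (auto simp: flip_nth bit_vectors_length split: if_splits)
qed

text \<open>The general semiring serves the degree over the naturals as well as the Laplacian over
  the integers.\<close>

lemma sum_hypercube_neighbours:
  fixes f :: "nat list \<Rightarrow> 'a :: comm_semiring_1"
  assumes a: "a \<in> bit_vectors d"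
  shows "(\<Sum>b\<in>bit_vectors d. of_nat (nedges (hypercube d) a b) * f b) = (\<Sum>i<d. f (flip i a))"
proof -
  have "(\<Sum>b\<in>bit_vectors d. of_nat (nedges (hypercube d) a b) * f b)
      = (\<Sum>b\<in>bit_vectors d. if nedges (hypercube d) a b = 1 then f b else 0)"
    by (rule sum.cong) (simp_all add: nedges_hypercube)
  also have "\<dots> = (\<Sum>b\<in>{b \<in> bit_vectors d. nedges (hypercube d) a b = 1}. f b)"
    by (simp add: sum.If_cases finite_bit_vectors Int_def)
  also have "\<dots> = (\<Sum>i<d. f (flip i a))"
    unfolding hypercube_neighbours[OF a] by (simp add: sum.reindex[OF flip_inj_index[OF a]])
  finally show ?thesis .
qed

lemma hypercube_connected:
  assumes S: "S \<subseteq> bit_vectors d" "S \<noteq> {}" and closed: "\<And>a i. a \<in> S \<Longrightarrow> i < d \<Longrightarrow> flip i a \<in> S"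
  shows "S = bit_vectors d"
proof -
  obtain a where a: "a \<in> S" using S by blast
  have "b \<in> S" if b: "b \<in> bit_vectors d" for b
  proof -
    have len: "length a = d" "length b = d" using a b S by (auto simp: bit_vectors_length)
    \<comment> \<open>A walk from \<open>a\<close> to \<open>b\<close> that corrects the coordinates
      from left to right, one flip at most per step.\<close>
    have "take m b @ drop m a \<in> S" if "m \<le> d" for m
      using that
    proof (induction m)
      case 0
      then show ?case using a by simp
    next
      case (Suc m)
      then have m: "m < d" by simp
      let ?c = "take m b @ drop m a"
      have c: "?c ! m = a ! m" using m len by (simp add: nth_append)
      have step: "take (Suc m) b @ drop (Suc m) a = ?c[m := b ! m]"
        using m len by (simp add: take_Suc_conv_app_nth list_update_append Cons_nth_drop_Suc[symmetric])
      show ?case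
      proof (cases "a ! m = b ! m")
        case True
        then have "?c[m := b ! m] = ?c" using c by (metis list_update_id)
        then show ?thesis using Suc step by simp
      next
        case False
        then have "?c[m := b ! m] = flip m ?c"
          using bit_vectors_nth[OF b m] bit_vectors_nth[of a d m] a S m c
          unfolding flip_def by fastforce
        then show ?thesis using Suc step closed[OF _ m] by simp
      qed
    qed
    from this[of d] show ?thesis using len by simp
  qed
  then show ?thesis using S by blast
qed

text \<open>Off-diagonal entries come in equal pairs.\<close>

lemma sum_symmetric_parity:
  fixes h :: "nat \<Rightarrow> nat \<Rightarrow> int"
  assumes "\<And>i j. h i j = h j i"
  shows "even ((\<Sum>i<d. \<Sum>j<d. h i j) - (\<Sum>i<d. h i i))"
proof (induction d)
  case (Suc d)
  have "(\<Sum>i<Suc d. \<Sum>j<Suc d. h i j) - (\<Sum>i<Suc d. h i i)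
      = ((\<Sum>i<d. \<Sum>j<d. h i j) - (\<Sum>i<d. h i i)) + ((\<Sum>i<d. h i d) + (\<Sum>j<d. h d j))"
    by (simp add: sum.distrib)
  also have "(\<Sum>i<d. h i d) = (\<Sum>j<d. h d j)"
    by (intro sum.cong refl assms)
  finally show ?case using Suc by simp
qed simp

lemma nonsink_cone: "nonsink (n_cone n G) None = Some ` vertices G"
  by (auto simp: nonsink_def n_cone_def)

lemma vertices_hypercube: "vertices (hypercube d) = bit_vectors d"
  by (simp add: hypercube_def)

text \<open>Oddness makes the multiplicity of the sink edges positive and all eigenvalues
  \<open>2 * |b| + n\<close> odd.\<close>

locale cube_cone =
  fixes d n :: nat
  assumes odd_n: "odd n"

sublocale cube_cone \<subseteq> sandpile "n_cone n (hypercube d)" None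
proof unfold_locales
  show "multigraph (n_cone n (hypercube d))"
    by (intro multigraph_n_cone multigraph_hypercube)
  show "None \<in> vertices (n_cone n (hypercube d))"
    by (simp add: n_cone_def)
  show "nedges (n_cone n (hypercube d)) None v > 0"
    if "v \<in> nonsink (n_cone n (hypercube d)) None" for v
    using that odd_n by (auto simp: n_cone_def nonsink_def odd_pos)
  show "nonsink (n_cone n (hypercube d)) None \<noteq> {}"
    using zero_bit_vectors by (auto simp: nonsink_cone vertices_hypercube)
  fix S assume S: "S \<subseteq> nonsink (n_cone n (hypercube d)) None" "S \<noteq> {}"
    and closed: "\<And>u v. \<lbrakk>u \<in> S; v \<in> nonsink (n_cone n (hypercube d)) None;
      nedges (n_cone n (hypercube d)) u v > 0\<rbrakk> \<Longrightarrow> v \<in> S"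
  have "{a. Some a \<in> S} = bit_vectors d"
  proof (rule hypercube_connected)
    show "{a. Some a \<in> S} \<subseteq> bit_vectors d" "{a. Some a \<in> S} \<noteq> {}"
      using S by (auto simp: nonsink_cone vertices_hypercube)
    fix a i assume "a \<in> {a. Some a \<in> S}" and i: "i < d"
    then have a: "Some a \<in> S" "a \<in> bit_vectors d"
      using S by (auto simp: nonsink_cone vertices_hypercube)
    have "flip i a \<in> {b \<in> bit_vectors d. nedges (hypercube d) a b = 1}"
      unfolding hypercube_neighbours[OF a(2)] using i by blast
    then have "Some (flip i a) \<in> S"
      using closed[OF a(1), of "Some (flip i a)"] unfolding nonsink_cone vertices_hypercube
      by (simp add: n_cone_def)
    then show "flip i a \<in> {a. Some a \<in> S}" by simp
  qed
  then show "S = nonsink (n_cone n (hypercube d)) None"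
    using S by (auto simp: nonsink_cone vertices_hypercube)
qed

section \<open>The Laplacian of a cone over the cube\<close>

context cube_cone
begin

abbreviation V :: "nat list set" where "V \<equiv> bit_vectors d"
text \<open>The Laplacian eigenvalue at \<open>chi b\<close>: the degree \<open>d + n\<close> minus
  the adjacency eigenvalue \<open>d - 2 * |b|\<close>.\<close>

abbreviation modulus :: "nat list \<Rightarrow> int" where "modulus b \<equiv> int (2 * sum_list b + n)"

lemma N_eq: "N = Some ` V"
  by (simp add: nonsink_cone vertices_hypercube)

lemma E_sink: "a \<in> V \<Longrightarrow> E None (Some a) = n"
  by (simp add: n_cone_def vertices_hypercube)

lemma E_cube: "E (Some a) (Some b) = nedges (hypercube d) a b"
  by (simp add: n_cone_def)

lemma deg_cube:
  assumes "a \<in> V"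
  shows "deg (Some a) = d + n"
proof -
  have "(\<Sum>u\<in>N. E (Some a) u) = (\<Sum>b\<in>V. of_nat (nedges (hypercube d) a b) * 1)"
    unfolding N_eq by (simp add: sum.reindex E_cube)
  also have "\<dots> = (\<Sum>i<d. 1)"
    using assms by (rule sum_hypercube_neighbours)
  finally show ?thesis
    using deg_eq[of "Some a"] E_sink[OF assms] by simp
qed

lemma lap_cube:
  assumes "a \<in> V"
  shows "lap x (Some a) = int (d + n) * x (Some a) - (\<Sum>i<d. x (Some (flip i a)))"
proof -
  have "(\<Sum>u\<in>N. int (E (Some a) u) * x u) = (\<Sum>b\<in>V. of_nat (nedges (hypercube d) a b) * x (Some b))"
    unfolding N_eq by (simp add: sum.reindex E_cube)
  also have "\<dots> = (\<Sum>i<d. x (Some (flip i a)))"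
    using assms by (rule sum_hypercube_neighbours)
  finally show ?thesis
    by (simp add: lap_def deg_cube[OF assms])
qed

section \<open>Fourier coefficients and the image of the Laplacian\<close>

definition phi :: "nat list \<Rightarrow> (nat list option \<Rightarrow> int) \<Rightarrow> int" where
  "phi b z = (\<Sum>a\<in>V. chi b a * z (Some a))"

lemma phi_add: "phi b (\<lambda>v. x v + y v) = phi b x + phi b y"
  by (simp add: phi_def algebra_simps sum.distrib)

lemma phi_diff: "phi b (\<lambda>v. x v - y v) = phi b x - phi b y"
  by (simp add: phi_def algebra_simps sum_subtractf)

lemma phi_cong: "(\<And>v. v \<in> N \<Longrightarrow> x v = y v) \<Longrightarrow> phi b x = phi b y"
  unfolding phi_def N_eq by (intro sum.cong) auto

text \<open>The Laplacian is symmetric: reindexing by flips moves it from \<open>x\<close> to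
  \<open>chi b\<close>, where it acts by its eigenvalue.\<close>

lemma phi_lap:
  assumes b: "b \<in> V"
  shows "phi b (lap x) = modulus b * phi b x"
proof -
  have "(\<Sum>a\<in>V. \<Sum>i<d. chi b a * x (Some (flip i a))) = (\<Sum>i<d. \<Sum>a\<in>V. chi b a * x (Some (flip i a)))"
    by (rule sum.swap)
  also have "\<dots> = (\<Sum>i<d. \<Sum>a\<in>V. chi b (flip i a) * x (Some a))"
  proof (rule sum.cong)
    fix i assume "i \<in> {..<d}"
    then have i: "i < d" by simp
    have "(\<Sum>a\<in>V. chi b a * x (Some (flip i a)))
        = (\<Sum>a\<in>V. chi b (flip i (flip i a)) * x (Some (flip i a)))"
      using i by (intro sum.cong) (auto simp: flip_flip)
    also have "\<dots> = (\<Sum>a\<in>V. chi b (flip i a) * x (Some a))"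
      using i by (rule sum_flip)
    finally show "(\<Sum>a\<in>V. chi b a * x (Some (flip i a))) = (\<Sum>a\<in>V. chi b (flip i a) * x (Some a))" .
  qed simp
  also have "\<dots> = (\<Sum>a\<in>V. (\<Sum>i<d. chi b (flip i a)) * x (Some a))"
    by (subst sum.swap) (simp add: sum_distrib_right)
  also have "\<dots> = (\<Sum>a\<in>V. (int d - 2 * int (sum_list b)) * (chi b a * x (Some a)))"
    using b by (intro sum.cong) (auto simp: sum_chi_flip)
  also have "\<dots> = (int d - 2 * int (sum_list b)) * phi b x"
    by (simp add: phi_def sum_distrib_left)
  finally have swap: "(\<Sum>a\<in>V. \<Sum>i<d. chi b a * x (Some (flip i a))) = (int d - 2 * int (sum_list b)) * phi b x" .
  have "phi b (lap x) = (\<Sum>a\<in>V. int (d + n) * (chi b a * x (Some a))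
      - (\<Sum>i<d. chi b a * x (Some (flip i a))))"
    unfolding phi_def by (intro sum.cong) (auto simp: lap_cube algebra_simps sum_distrib_left)
  also have "\<dots> = int (d + n) * phi b x - (int d - 2 * int (sum_list b)) * phi b x"
    unfolding sum_subtractf swap by (simp add: phi_def sum_distrib_left)
  finally show ?thesis by (simp add: algebra_simps)
qed

text \<open>The factor \<open>2 ^ d\<close> is kept on the right so that everything stays
  integral.\<close>

lemma phi_inversion:
  assumes "a \<in> V"
  shows "(\<Sum>b\<in>V. phi b z * chi b a) = 2 ^ d * z (Some a)"
proof -
  have "(\<Sum>b\<in>V. phi b z * chi b a) = (\<Sum>b\<in>V. \<Sum>a'\<in>V. chi b a' * chi b a * z (Some a'))"
    by (simp add: phi_def sum_distrib_left sum_distrib_right algebra_simps)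
  also have "\<dots> = (\<Sum>a'\<in>V. (\<Sum>b\<in>V. chi b a' * chi b a) * z (Some a'))"
    by (subst sum.swap) (simp add: sum_distrib_right)
  also have "\<dots> = (\<Sum>a'\<in>V. if a' = a then 2 ^ d * z (Some a') else 0)"
    using assms by (intro sum.cong) (auto simp: chi_orthogonal')
  also have "\<dots> = 2 ^ d * z (Some a)"
    using assms by (simp add: finite_bit_vectors)
  finally show ?thesis .
qed

definition of_cube :: "(nat list \<Rightarrow> int) \<Rightarrow> nat list option \<Rightarrow> int" where
  "of_cube f v = (case v of None \<Rightarrow> 0 | Some a \<Rightarrow> f a)"

lemma of_cube_Some [simp]: "of_cube f (Some a) = f a"
  by (simp add: of_cube_def)

text \<open>The characters diagonalize the Laplacian, so preimages can be written down from Fourier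
  coefficients.\<close>

lemma lap_chi_combination:
  assumes a: "a \<in> V"
  shows "lap (of_cube (\<lambda>a. \<Sum>b\<in>V. u b * chi b a)) (Some a) = (\<Sum>b\<in>V. modulus b * u b * chi b a)"
proof -
  have "(\<Sum>i<d. \<Sum>b\<in>V. u b * chi b (flip i a)) = (\<Sum>b\<in>V. u b * (\<Sum>i<d. chi b (flip i a)))"
    by (subst sum.swap) (simp add: sum_distrib_left)
  also have "\<dots> = (\<Sum>b\<in>V. (int d - 2 * int (sum_list b)) * u b * chi b a)"
    using a by (intro sum.cong) (auto simp: sum_chi_flip)
  finally have "lap (of_cube (\<lambda>a. \<Sum>b\<in>V. u b * chi b a)) (Some a)
      = (\<Sum>b\<in>V. int (d + n) * u b * chi b a) - (\<Sum>b\<in>V. (int d - 2 * int (sum_list b)) * u b * chi b a)"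
    using a by (simp add: lap_cube sum_distrib_left mult.assoc)
  also have "\<dots> = (\<Sum>b\<in>V. modulus b * u b * chi b a)"
    unfolding sum_subtractf[symmetric] by (intro sum.cong) (auto simp: algebra_simps)
  finally show ?thesis .
qed

text \<open>Modulo 2 the square of the adjacency matrix of the cube is \<open>d\<close> times the identity, and the
  number of edges to the sink is odd, so the Laplacian is an involution modulo 2.\<close>

lemma lap_lap_parity:
  assumes a: "a \<in> V"
  shows "even (lap (lap x) (Some a) - x (Some a))"
proof -
  define D where "D = int (d + n)"
  \<comment> \<open>The value of \<open>x\<close> two flips away from \<open>a\<close>. It is
    symmetric in \<open>i\<close> and \<open>j\<close> because flips commute, and its diagonal
    returns to \<open>a\<close>.\<close>
  define h where "h i j = x (Some (flip j (flip i a)))" for i j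
  have h_diag: "(\<Sum>i<d. h i i) = int d * x (Some a)"
    using a by (simp add: h_def flip_flip)
  have "lap (lap x) (Some a) = D * (D * x (Some a) - (\<Sum>i<d. x (Some (flip i a))))
      - (\<Sum>i<d. D * x (Some (flip i a)) - (\<Sum>j<d. h i j))"
    using a by (simp add: lap_cube flip_bit_vectors D_def h_def)
  also have "\<dots> = D * D * x (Some a) - 2 * (D * (\<Sum>i<d. x (Some (flip i a)))) + (\<Sum>i<d. \<Sum>j<d. h i j)"
    by (simp add: sum_subtractf sum_distrib_left algebra_simps)
  finally have "lap (lap x) (Some a) - x (Some a) =
      (D * D + int d - 1) * x (Some a) - 2 * (D * (\<Sum>i<d. x (Some (flip i a))))
      + ((\<Sum>i<d. \<Sum>j<d. h i j) - (\<Sum>i<d. h i i))"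
    by (simp add: h_diag algebra_simps)
  moreover have "even ((\<Sum>i<d. \<Sum>j<d. h i j) - (\<Sum>i<d. h i i))"
    by (rule sum_symmetric_parity) (simp add: h_def flip_commute)
  \<comment> \<open>As \<open>n\<close> is odd, \<open>D\<close> and hence \<open>D * D\<close> have
    the parity of \<open>d + 1\<close>.\<close>
  moreover have "even (D * D + int d - 1)"
    using odd_n by (simp add: D_def)
  ultimately show ?thesis by simp
qed

text \<open>Applying \<open>lap\<close> once more makes the right-hand side
  \<open>lap (lap w)\<close>, which is congruent to \<open>w\<close> modulo 2. So \<open>w\<close>
  is even on \<open>N\<close>, and half of it is an integral preimage of \<open>z\<close>.\<close>

lemma lap_image_halve:
  assumes "\<And>v. v \<in> N \<Longrightarrow> 2 * z v = lap w v"
  obtains w' where "\<And>v. v \<in> N \<Longrightarrow> z v = lap w' v"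
proof -
  have w: "w v = 2 * (w v div 2)" if v: "v \<in> N" for v
  proof -
    obtain a where a: "a \<in> V" "v = Some a" using v by (auto simp: N_eq)
    have "lap (lap w) v = lap (\<lambda>u. 2 * z u) v"
      using assms v by (intro lap_cong) auto
    then have "even (lap (lap w) v)" by (simp add: lap_scale)
    then have "even (w v)" using lap_lap_parity[OF a(1), of w] a(2) by simp
    then show ?thesis by simp
  qed
  have "z v = lap (\<lambda>u. w u div 2) v" if "v \<in> N" for v
  proof -
    have "lap w v = lap (\<lambda>u. 2 * (w u div 2)) v"
      using w that by (intro lap_cong) auto
    then show ?thesis
      using assms[OF that] by (simp add: lap_scale)
  qed
  then show thesis by (rule that)
qed

lemma lap_image_divide_power2:
  assumes "\<And>v. v \<in> N \<Longrightarrow> 2 ^ m * z v = lap w v"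
  shows "\<exists>w'. \<forall>v\<in>N. z v = lap w' v"
  using assms
proof (induction m arbitrary: w)
  case 0
  then show ?case by auto
next
  case (Suc m)
  then obtain w' where "\<And>v. v \<in> N \<Longrightarrow> 2 ^ m * z v = lap w' v"
    using lap_image_halve[of "\<lambda>v. 2 ^ m * z v" w] by (metis mult.assoc power_Suc)
  then show ?case by (rule Suc.IH)
qed

text \<open>One direction is \<open>phi_lap\<close>. For the other, dividing the coefficients of
  \<open>z - w\<close> by the eigenvalues gives a preimage of \<open>2 ^ d\<close> times the
  difference, and the power of 2 is then removed.\<close>

lemma lap_equiv_iff:
  "lap_equiv z w \<longleftrightarrow> (\<forall>b\<in>V. [phi b z = phi b w] (mod modulus b))"
proof
  assume "lap_equiv z w"
  then obtain x where x: "\<forall>v\<in>N. z v - w v = lap x v"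
    by (auto simp: lap_equiv_def)
  have "phi b z - phi b w = modulus b * phi b x" if "b \<in> V" for b
    using phi_cong[of "\<lambda>v. z v - w v" "lap x" b] x phi_lap[OF that] by (simp add: phi_diff)
  then show "\<forall>b\<in>V. [phi b z = phi b w] (mod modulus b)"
    by (simp add: cong_iff_dvd_diff)
next
  assume *: "\<forall>b\<in>V. [phi b z = phi b w] (mod modulus b)"
  define u where "u b = phi b (\<lambda>v. z v - w v) div modulus b" for b
  have u: "modulus b * u b = phi b (\<lambda>v. z v - w v)" if "b \<in> V" for b
    unfolding u_def using * that by (intro dvd_mult_div_cancel) (auto simp: cong_iff_dvd_diff phi_diff)
  have "2 ^ d * (z v - w v) = lap (of_cube (\<lambda>a. \<Sum>b\<in>V. u b * chi b a)) v" if v: "v \<in> N" for v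
  proof -
    obtain a where a: "a \<in> V" "v = Some a" using v by (auto simp: N_eq)
    have "lap (of_cube (\<lambda>a. \<Sum>b\<in>V. u b * chi b a)) v = (\<Sum>b\<in>V. modulus b * u b * chi b a)"
      using a by (simp only: lap_chi_combination)
    also have "\<dots> = (\<Sum>b\<in>V. phi b (\<lambda>v. z v - w v) * chi b a)"
      by (intro sum.cong) (auto simp only: u)
    also have "\<dots> = 2 ^ d * (z v - w v)"
      using phi_inversion[OF a(1), of "\<lambda>v. z v - w v"] a(2) by simp
    finally show ?thesis by simp
  qed
  then show "lap_equiv z w"
    unfolding lap_equiv_def by (rule lap_image_divide_power2)
qed

lemma recurrent_cong_unique:
  assumes "recurrent (n_cone n (hypercube d)) None a" "recurrent (n_cone n (hypercube d)) None b"
    "\<And>g. g \<in> V \<Longrightarrow> [phi g (int \<circ> a) = phi g (int \<circ> b)] (mod modulus g)"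
  shows "a = b"
  using assms by (intro recurrent_unique) (auto simp: lap_equiv_iff)

lemma phi_mult_SP:
  assumes "b \<in> V"
  shows "[phi b (int \<circ> (x \<otimes>\<^bsub>SP\<^esub> y)) = phi b (int \<circ> x) + phi b (int \<circ> y)] (mod modulus b)"
proof -
  have "[phi b (int \<circ> (x \<otimes>\<^bsub>SP\<^esub> y)) = phi b (\<lambda>v. int (x v) + int (y v))] (mod modulus b)"
    using mult_SP_lap_equiv assms unfolding lap_equiv_iff by blast
  then show ?thesis by (simp only: phi_add comp_def)
qed

lemma solve_mod:
  "\<exists>c. [2 ^ m * c = t] (mod modulus b)"
proof -
  have "coprime (2 ^ m) (modulus b)" using odd_n by simp
  then obtain x where "[2 ^ m * x = 1] (mod modulus b)"
    using cong_solve_coprime_int by blast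
  then have "[2 ^ m * x * t = 1 * t] (mod modulus b)"
    by (rule cong_scalar_right)
  then show ?thesis by (intro exI[of _ "x * t"]) (simp add: mult.assoc)
qed

text \<open>By orthogonality the combination with coefficients \<open>u b\<close> pairs with
  \<open>chi b\<close> to \<open>2 ^ d * u b\<close>. The residues can thus be prescribed
  independently, even where moduli coincide or share factors.\<close>

lemma recurrent_with_residues:
  obtains c where "recurrent (n_cone n (hypercube d)) None c"
    "\<And>b. b \<in> V \<Longrightarrow> [phi b (int \<circ> c) = t b] (mod modulus b)"
proof -
  obtain u where u: "\<And>b. [2 ^ d * u b = t b] (mod modulus b)"
    using choice[of "\<lambda>b c. [2 ^ d * c = t b] (mod modulus b)"] solve_mod by blast
  define z where "z = of_cube (\<lambda>a. \<Sum>b\<in>V. u b * chi b a)"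
  obtain c where c: "recurrent (n_cone n (hypercube d)) None c" "lap_equiv (int \<circ> c) z"
    by (rule recurrent_exists)
  have "[phi b (int \<circ> c) = t b] (mod modulus b)" if b: "b \<in> V" for b
  proof -
    have "phi b z = (\<Sum>a\<in>V. \<Sum>g\<in>V. u g * (chi b a * chi g a))"
      by (simp add: phi_def z_def sum_distrib_left algebra_simps)
    also have "\<dots> = (\<Sum>g\<in>V. u g * (\<Sum>a\<in>V. chi b a * chi g a))"
      by (subst sum.swap) (simp add: sum_distrib_left)
    also have "\<dots> = (\<Sum>g\<in>V. if g = b then 2 ^ d * u g else 0)"
      using b by (intro sum.cong) (auto simp: chi_orthogonal)
    also have "\<dots> = 2 ^ d * u b"
      using b by (simp add: finite_bit_vectors)
    finally show ?thesis
      using c(2) b u[of b] cong_trans unfolding lap_equiv_iff by metis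
  qed
  with c(1) show thesis by (rule that)
qed

section \<open>The isomorphism with a sum of cyclic groups\<close>

abbreviation rec :: "(nat list option \<Rightarrow> nat) \<Rightarrow> bool" where
  "rec \<equiv> recurrent (n_cone n (hypercube d)) None"

text \<open>The target group numbers its summands of order \<open>2 * i + n\<close> by
  \<open>j < d choose i\<close>; any bijection onto the bit vectors of weight \<open>i\<close> will
  do.\<close>

definition weight_enum :: "nat \<Rightarrow> nat \<Rightarrow> nat list" where
  "weight_enum i = (SOME e. bij_betw e {..<d choose i} {b \<in> V. sum_list b = i})"

lemma weight_enum: "bij_betw (weight_enum i) {..<d choose i} {b \<in> V. sum_list b = i}"
proof -
  have "finite {b \<in> V. sum_list b = i}" by (simp add: finite_bit_vectors)
  from ex_bij_betw_nat_finite[OF this]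
  have "\<exists>e. bij_betw e {..<d choose i} {b \<in> V. sum_list b = i}"
    by (simp only: card_bit_vectors_weight atLeast0LessThan)
  then show ?thesis unfolding weight_enum_def by (rule someI_ex)
qed

lemma weight_enum_in: "j < d choose i \<Longrightarrow> weight_enum i j \<in> V"
  and sum_list_weight_enum: "j < d choose i \<Longrightarrow> sum_list (weight_enum i j) = i"
  using bij_betwE[OF weight_enum[of i]] by auto

lemma weight_enum_surj:
  assumes "b \<in> V"
  obtains j where "j < d choose sum_list b" "weight_enum (sum_list b) j = b"
proof -
  have "b \<in> weight_enum (sum_list b) ` {..<d choose sum_list b}"
    using bij_betw_imp_surj_on[OF weight_enum[of "sum_list b"]] assms by simp
  then obtain j where "b = weight_enum (sum_list b) j" "j \<in> {..<d choose sum_list b}"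
    by (rule imageE)
  then show thesis
    using that[of j] by simp
qed

text \<open>Both restrictions are needed because elements of a \<open>sum_group\<close> are
  extensional functions.\<close>

definition residues :: "(nat list option \<Rightarrow> nat) \<Rightarrow> nat \<Rightarrow> nat \<Rightarrow> int" where
  "residues c = (\<lambda>i\<in>{0..d}. \<lambda>j\<in>{..<d choose i}.
     phi (weight_enum i j) (int \<circ> c) mod int (2 * i + n))"

abbreviation residue_group :: "(nat \<Rightarrow> nat \<Rightarrow> int) monoid" where
  "residue_group \<equiv> sum_group {0..d} (\<lambda>i. sum_group {..<d choose i} (\<lambda>_. integer_mod_group (2 * i + n)))"

lemma carrier_residue_group:
  "carrier residue_group = (\<Pi>\<^sub>E i\<in>{0..d}. \<Pi>\<^sub>E j\<in>{..<d choose i}. {0..<int (2 * i + n)})"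
proof -
  \<comment> \<open>For modulus 0 the carrier of \<open>integer_mod_group\<close> would be all
    integers instead of an interval.\<close>
  have "n \<noteq> 0" using odd_n by (auto elim: oddE)
  then show ?thesis by (simp add: carrier_sum_group carrier_integer_mod_group)
qed

lemma residues_hom: "residues \<in> hom SP residue_group"
proof (rule homI)
  fix x assume "x \<in> carrier SP"
  have "int (2 * i + n) > 0" for i using odd_n by (auto elim: oddE)
  then show "residues x \<in> carrier residue_group"
    unfolding carrier_residue_group residues_def
    by (intro restrict_PiE_iff[THEN iffD2] ballI) simp
next
  fix x y
  have "phi (weight_enum i j) (int \<circ> (x \<otimes>\<^bsub>SP\<^esub> y)) mod int (2 * i + n) =
      (phi (weight_enum i j) (int \<circ> x) mod int (2 * i + n)
        + phi (weight_enum i j) (int \<circ> y) mod int (2 * i + n)) mod int (2 * i + n)"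
    if "j < d choose i" for i j
    using phi_mult_SP[OF weight_enum_in[OF that], of x y] sum_list_weight_enum[OF that]
    unfolding cong_def mod_add_eq by simp
  then show "residues (x \<otimes>\<^bsub>SP\<^esub> y) = residues x \<otimes>\<^bsub>residue_group\<^esub> residues y"
    by (auto simp: residues_def fun_eq_iff restrict_def)
qed

lemma residues_eq_cong:
  assumes "residues x = residues y" "b \<in> V"
  shows "[phi b (int \<circ> x) = phi b (int \<circ> y)] (mod modulus b)"
proof -
  obtain j where j: "j < d choose sum_list b" "weight_enum (sum_list b) j = b"
    using weight_enum_surj[OF assms(2)] by blast
  have "residues x (sum_list b) j = residues y (sum_list b) j"
    using assms(1) by simp
  then show ?thesis
    using j sum_list_bits_le[OF assms(2)] by (simp add: residues_def cong_def)
qed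

text \<open>Residues determine the class and the class its recurrent configuration, which gives
  injectivity; surjectivity is \<open>recurrent_with_residues\<close>.\<close>

lemma residues_iso: "residues \<in> iso SP residue_group"
  unfolding iso_def
proof (intro CollectI conjI residues_hom)
  show "bij_betw residues (carrier SP) (carrier residue_group)"
  proof (rule bij_betw_imageI)
    show "inj_on residues (carrier SP)"
      using residues_eq_cong recurrent_cong_unique by (auto simp: inj_on_def carrier_SP)
    have "f \<in> residues ` carrier SP" if f: "f \<in> carrier residue_group" for f
    proof -
      \<comment> \<open>Turns the double index of \<open>f\<close> into a bit vector by inverting
        the enumeration.\<close>
      define t where "t b = f (sum_list b) (inv_into {..<d choose sum_list b} (weight_enum (sum_list b)) b)" for b
      obtain c where c: "rec c" "\<And>b. b \<in> V \<Longrightarrow> [phi b (int \<circ> c) = t b] (mod modulus b)"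
        using recurrent_with_residues[of t] by blast
      have f_PiE: "f \<in> (\<Pi>\<^sub>E i\<in>{0..d}. \<Pi>\<^sub>E j\<in>{..<d choose i}. {0..<int (2 * i + n)})"
        using f by (simp only: carrier_residue_group)
      have res: "residues c i j = f i j" if i: "i \<le> d" and j: "j < d choose i" for i j
      proof -
        have "t (weight_enum i j) = f i j"
          using bij_betw_imp_inj_on[OF weight_enum[of i]] j
          by (simp add: t_def sum_list_weight_enum inv_into_f_f)
        moreover have "f i j \<in> {0..<int (2 * i + n)}"
          using f_PiE i j by (auto simp: PiE_iff)
        ultimately show ?thesis
          using c(2)[OF weight_enum_in[OF j]] i j
          by (simp add: residues_def cong_def sum_list_weight_enum)
      qed
      have "residues c i j = f i j" for i j
      proof (cases "i \<le> d \<and> j < d choose i")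
        case False
        \<comment> \<open>Off the index sets both sides take the default value of extensional
          functions.\<close>
        have "f i = undefined" if "\<not> i \<le> d"
          using f_PiE that by (auto simp: PiE_iff extensional_def)
        moreover have "f i j = undefined" if "i \<le> d" "\<not> j < d choose i"
          using f_PiE that by (auto simp: PiE_iff extensional_def)
        ultimately show ?thesis using False by (auto simp: residues_def)
      qed (use res in blast)
      then have "f = residues c" by (simp add: fun_eq_iff)
      then show ?thesis using c(1) by (simp add: carrier_SP)
    qed
    then show "residues ` carrier SP = carrier residue_group"
      using residues_hom by (auto simp: hom_def)
  qed
qed

section \<open>Decomposition by characters\<close>

lemma phi_finprod_SP:
  assumes "b \<in> V" "finite I" "f \<in> I \<rightarrow> carrier SP"
  shows "[phi b (int \<circ> finprod SP f I) = (\<Sum>i\<in>I. phi b (int \<circ> f i))] (mod modulus b)"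
proof -
  interpret SP: comm_group SP by (rule comm_group_SP)
  show ?thesis
    using assms(2,3)
  proof (induction I rule: finite_induct)
    case empty
    \<comment> \<open>The neutral element is idempotent, so its residue equals its own double and
      vanishes.\<close>
    have "[phi b (int \<circ> (\<one>\<^bsub>SP\<^esub> \<otimes>\<^bsub>SP\<^esub> \<one>\<^bsub>SP\<^esub>)) = phi b (int \<circ> \<one>\<^bsub>SP\<^esub>) + phi b (int \<circ> \<one>\<^bsub>SP\<^esub>)] (mod modulus b)"
      using assms(1) by (rule phi_mult_SP)
    then show ?case by (simp add: cong_iff_dvd_diff comp_def)
  next
    case (insert i I)
    have "finprod SP f (insert i I) = f i \<otimes>\<^bsub>SP\<^esub> finprod SP f I"
      using insert by (intro SP.finprod_insert) auto
    then have "[phi b (int \<circ> finprod SP f (insert i I)) = phi b (int \<circ> f i) + phi b (int \<circ> finprod SP f I)] (mod modulus b)"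
      using phi_mult_SP[OF assms(1)] by simp
    moreover have "[phi b (int \<circ> f i) + phi b (int \<circ> finprod SP f I) = phi b (int \<circ> f i) + (\<Sum>i\<in>I. phi b (int \<circ> f i))] (mod modulus b)"
      using insert.prems by (intro cong_add cong_refl insert.IH) auto
    ultimately show ?case
      unfolding sum.insert[OF insert(1,2)] by (rule cong_trans)
  qed
qed

text \<open>Under \<open>residues\<close> this corresponds to the single cyclic summand belonging to
  \<open>b\<close>, if \<open>b\<close> is a vertex.\<close>

definition isotypic :: "nat list \<Rightarrow> (nat list option \<Rightarrow> nat) set" where
  "isotypic b = {c. rec c \<and> (\<forall>g\<in>V. g \<noteq> b \<longrightarrow> [phi g (int \<circ> c) = 0] (mod modulus g))}"

lemma isotypic_subgroup: "subgroup (isotypic b) SP"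
proof -
  interpret SP: comm_group SP by (rule comm_group_SP)
  have one: "[phi g (int \<circ> \<one>\<^bsub>SP\<^esub>) = 0] (mod modulus g)" if "g \<in> V" for g
    using phi_finprod_SP[OF that, of "{}"] by simp
  show ?thesis
  proof (rule SP.subgroupI)
    show "isotypic b \<subseteq> carrier SP"
      by (auto simp: isotypic_def carrier_SP)
    have "\<one>\<^bsub>SP\<^esub> \<in> isotypic b"
      using SP.one_closed one by (simp add: isotypic_def carrier_SP)
    then show "isotypic b \<noteq> {}" by blast
  next
    fix x assume x: "x \<in> isotypic b"
    then have car: "x \<in> carrier SP" by (auto simp: isotypic_def carrier_SP)
    have "[phi g (int \<circ> inv\<^bsub>SP\<^esub> x) = 0] (mod modulus g)" if g: "g \<in> V" "g \<noteq> b" for g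
    proof -
      have "[phi g (int \<circ> \<one>\<^bsub>SP\<^esub>) = phi g (int \<circ> inv\<^bsub>SP\<^esub> x) + phi g (int \<circ> x)] (mod modulus g)"
        using phi_mult_SP[OF g(1), of "inv\<^bsub>SP\<^esub> x" x] car by simp
      moreover have "[phi g (int \<circ> x) = 0] (mod modulus g)"
        using x g by (simp add: isotypic_def)
      ultimately show ?thesis
        using one[OF g(1)] unfolding cong_0_iff cong_iff_dvd_diff by (smt (verit) dvd_add_right_iff dvd_diff)
    qed
    then show "inv\<^bsub>SP\<^esub> x \<in> isotypic b"
      using SP.inv_closed[OF car] by (simp add: isotypic_def carrier_SP)
  next
    fix x y assume xy: "x \<in> isotypic b" "y \<in> isotypic b"
    then have "x \<otimes>\<^bsub>SP\<^esub> y \<in> carrier SP"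
      by (intro SP.m_closed) (auto simp: isotypic_def carrier_SP)
    moreover have "[phi g (int \<circ> (x \<otimes>\<^bsub>SP\<^esub> y)) = 0] (mod modulus g)" if g: "g \<in> V" "g \<noteq> b" for g
    proof -
      have "[phi g (int \<circ> x) + phi g (int \<circ> y) = 0 + 0] (mod modulus g)"
        using xy g by (intro cong_add) (simp_all add: isotypic_def)
      then show ?thesis
        using phi_mult_SP[OF g(1), of x y] cong_trans by fastforce
    qed
    ultimately show "x \<otimes>\<^bsub>SP\<^esub> y \<in> isotypic b"
      by (simp add: isotypic_def carrier_SP)
  qed
qed

lemma phi_finprod_isotypic:
  assumes f: "f \<in> (\<Pi>\<^sub>E b\<in>V. isotypic b)" and g: "g \<in> V"
  shows "[phi g (int \<circ> finprod SP f V) = phi g (int \<circ> f g)] (mod modulus g)"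
proof -
  have "f \<in> V \<rightarrow> carrier SP"
    using f by (auto simp: isotypic_def carrier_SP PiE_iff)
  then have "[phi g (int \<circ> finprod SP f V) = (\<Sum>b\<in>V. phi g (int \<circ> f b))] (mod modulus g)"
    using g by (intro phi_finprod_SP finite_bit_vectors)
  also have "[(\<Sum>b\<in>V. phi g (int \<circ> f b)) = (\<Sum>b\<in>V. if b = g then phi g (int \<circ> f b) else 0)] (mod modulus g)"
    using f g by (intro cong_sum) (auto simp: isotypic_def PiE_iff)
  finally show ?thesis
    using g by (simp add: finite_bit_vectors)
qed

text \<open>The component of \<open>x\<close> at \<open>b\<close> has the residue of
  \<open>x\<close> at \<open>b\<close> and residue 0 elsewhere. \<open>phi_finprod_isotypic\<close>
  reads these residues off any decomposition, whence uniqueness.\<close>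

lemma internal_direct_sum_isotypic: "internal_direct_sum SP V isotypic"
  unfolding internal_direct_sum_def
proof (intro conjI ballI comm_group_SP finite_bit_vectors isotypic_subgroup)
  interpret SP: comm_group SP by (rule comm_group_SP)
  fix x assume x: "x \<in> carrier SP"
  have "\<exists>c. c \<in> isotypic b \<and> [phi b (int \<circ> c) = phi b (int \<circ> x)] (mod modulus b)" if b: "b \<in> V" for b
  proof -
    obtain c where c: "rec c"
      "\<And>g. g \<in> V \<Longrightarrow> [phi g (int \<circ> c) = (if g = b then phi b (int \<circ> x) else 0)] (mod modulus g)"
      using recurrent_with_residues[of "\<lambda>g. if g = b then phi b (int \<circ> x) else 0"] by blast
    have "[phi g (int \<circ> c) = 0] (mod modulus g)" if "g \<in> V" "g \<noteq> b" for g
      using c(2)[OF that(1)] that(2) by simp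
    then have "c \<in> isotypic b" using c(1) by (simp add: isotypic_def)
    moreover have "[phi b (int \<circ> c) = phi b (int \<circ> x)] (mod modulus b)"
      using c(2)[OF b] by simp
    ultimately show ?thesis by blast
  qed
  then obtain f where f: "\<And>b. b \<in> V \<Longrightarrow> f b \<in> isotypic b"
    "\<And>b. b \<in> V \<Longrightarrow> [phi b (int \<circ> f b) = phi b (int \<circ> x)] (mod modulus b)"
    by metis
  have car: "h \<in> V \<rightarrow> carrier SP" if "h \<in> (\<Pi>\<^sub>E b\<in>V. isotypic b)" for h
    using that by (auto simp: isotypic_def carrier_SP PiE_iff)
  define h where "h = restrict f V"
  have h: "h \<in> (\<Pi>\<^sub>E b\<in>V. isotypic b)"
    using f(1) by (simp add: h_def)
  show "\<exists>!f. f \<in> (\<Pi>\<^sub>E b\<in>V. isotypic b) \<and> finprod SP f V = x"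
  proof (rule ex1I[of _ h], intro conjI h)
    show "finprod SP h V = x"
    proof (rule recurrent_cong_unique)
      show "rec (finprod SP h V)" "rec x"
        using SP.finprod_closed[OF car[OF h]] x by (simp_all add: carrier_SP)
      fix g assume g: "g \<in> V"
      have "[phi g (int \<circ> h g) = phi g (int \<circ> x)] (mod modulus g)"
        using f(2)[OF g] g by (simp add: h_def)
      with phi_finprod_isotypic[OF h g]
      show "[phi g (int \<circ> finprod SP h V) = phi g (int \<circ> x)] (mod modulus g)"
        by (rule cong_trans)
    qed
  next
    fix f' assume f': "f' \<in> (\<Pi>\<^sub>E b\<in>V. isotypic b) \<and> finprod SP f' V = x"
    have "f' b = h b" if b: "b \<in> V" for b
    proof (rule recurrent_cong_unique)
      have iso: "f' b \<in> isotypic b" "h b \<in> isotypic b"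
        using f' h b by (auto simp: PiE_iff)
      then show "rec (f' b)" "rec (h b)"
        by (simp_all add: isotypic_def)
      fix g assume g: "g \<in> V"
      show "[phi g (int \<circ> f' b) = phi g (int \<circ> h b)] (mod modulus g)"
      proof (cases "g = b")
        case True
        have "[phi b (int \<circ> f' b) = phi b (int \<circ> x)] (mod modulus b)"
          using phi_finprod_isotypic[of f', OF _ b] f' by (simp add: cong_sym)
        moreover have "[phi b (int \<circ> x) = phi b (int \<circ> h b)] (mod modulus b)"
          using f(2)[OF b] b by (simp add: h_def cong_sym)
        ultimately show ?thesis
          unfolding True by (rule cong_trans)
      next
        case False
        then have "[phi g (int \<circ> f' b) = 0] (mod modulus g)" "[0 = phi g (int \<circ> h b)] (mod modulus g)"
          using iso g by (simp_all add: isotypic_def cong_sym)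
        then show ?thesis by (rule cong_trans)
      qed
    qed
    then show "f' = h"
      using f' h by (intro PiE_ext[of f' V isotypic h]) auto
  qed
qed

end

section \<open>The subgroups indexed by bit vectors\<close>

text \<open>For the \<open>r\<close> and \<open>t\<close> allowed in \<open>K_tilde\<close>, the
  shift \<open>d - |b|\<close> raises the larger value to \<open>d\<close>, the largest stable value
  in the 1-cone.\<close>

definition K_conf :: "nat \<Rightarrow> nat list \<Rightarrow> nat \<Rightarrow> nat \<Rightarrow> nat list option \<Rightarrow> nat" where
  "K_conf d b r t = (\<lambda>x. g_conf d b r t x + (d - sum_list b) * ones_conf d x)"

lemma K_conf_Some:
  "a \<in> bit_vectors d \<Longrightarrow> K_conf d b r t (Some a) = (if even (dot b a) then r else t) + (d - sum_list b)"
  by (simp add: K_conf_def g_conf_def ones_conf_def)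

lemma K_tilde_eq:
  "K_tilde d b = {K_conf d b r t | r t.
     r \<le> sum_list b \<and> t \<le> sum_list b \<and> (r = sum_list b \<or> t = sum_list b)}"
  by (simp add: K_tilde_def K_conf_def)

locale cube_cone1 = cube_cone +
  assumes n_eq: "n = 1"

context cube_cone1
begin

lemma deg_cube1: "a \<in> V \<Longrightarrow> deg (Some a) = d + 1"
  and E_sink1: "a \<in> V \<Longrightarrow> E None (Some a) = 1"
  using deg_cube E_sink n_eq by metis+

text \<open>After the sink fires, all vertices of the parity class with value \<open>d\<close> topple; this
  destabilizes the other class, because each of its vertices has \<open>|b|\<close> neighbours in the first one.\<close>

lemma K_conf_recurrent:
  assumes b: "b \<in> V" and rt: "r \<le> sum_list b" "t \<le> sum_list b" "r = sum_list b \<or> t = sum_list b"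
  shows "rec (K_conf d b r t)"
  unfolding recurrent_iff
proof (intro conjI)
  let ?c = "K_conf d b r t" and ?m = "sum_list b"
  have m: "?m \<le> d" using b by (rule sum_list_bits_le)
  show "?c \<in> configurations (n_cone n (hypercube d)) None"
    by (auto simp: configurations_def nonsink_cone vertices_hypercube K_conf_def g_conf_def ones_conf_def
        split: option.splits)
  show stable: "stable (n_cone n (hypercube d)) None ?c"
    unfolding stable_def stable_vertex_def N_eq using rt m by (auto simp: deg_cube1 K_conf_Some)
  \<comment> \<open>Selects a parity class on which the value is \<open>d\<close>, the even one in
    case of a tie; \<open>y\<close> below is its indicator.\<close>
  define p where "p \<longleftrightarrow> r = ?m"
  define y :: "nat list option \<Rightarrow> nat"
    where "y v = (case v of None \<Rightarrow> 0 | Some a \<Rightarrow> (if even (dot b a) = p then 1 else 0))" for v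
  have y_Some: "y (Some a) = (if even (dot b a) = p then 1 else 0)" for a
    by (simp add: y_def)
  have c_high: "?c (Some a) = d" if "a \<in> V" "even (dot b a) = p" for a
    using that rt m by (auto simp: K_conf_Some p_def split: if_splits)
  have c_low: "d \<le> ?c (Some a) + ?m" if "a \<in> V" for a
    using that m by (auto simp: K_conf_Some)
  have "deg v * y v \<le> ?c v + E None v" if v: "v \<in> N" for v
    using v c_high by (auto simp: N_eq y_Some deg_cube1 E_sink1)
  then obtain c' where c': "T\<^sup>*\<^sup>* (\<lambda>v. ?c v + E None v) c'"
    "\<And>v. v \<in> N \<Longrightarrow> int (c' v) = int (?c v + E None v) - lap (int \<circ> y) v"
    "\<And>v. v \<notin> N \<Longrightarrow> c' v = ?c v + E None v"
    using multi_topple[of y "\<lambda>v. ?c v + E None v"] by blast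
  have low: "d + 1 \<le> c' (Some a)" if a: "a \<in> V" and ap: "even (dot b a) \<noteq> p" for a
  proof -
    \<comment> \<open>From the other class, flipping coordinate \<open>i\<close> leads into the
      first class exactly when \<open>b ! i = 1\<close>.\<close>
    have "y (Some (flip i a)) = b ! i" if "i < d" for i
      using even_dot_flip[OF a b that] bit_vectors_nth[OF b that] ap by (auto simp: y_Some)
    then have "lap (int \<circ> y) (Some a) = - int ?m"
      using a ap b by (simp add: lap_cube y_Some sum_list_bits)
    then have "int (c' (Some a)) = int (?c (Some a)) + 1 + int ?m"
      using c'(2)[of "Some a"] a by (simp add: N_eq E_sink1)
    then show ?thesis using c_low[OF a] by linarith
  qed
  have y_le: "y v \<le> 1" for v by (simp add: y_def split: option.splits)
  have "deg v * (1 - y v) \<le> c' v" if v: "v \<in> N" for v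
    using v low by (auto simp: N_eq y_Some deg_cube1)
  then obtain c'' where c'': "T\<^sup>*\<^sup>* c' c''"
    "\<And>v. v \<in> N \<Longrightarrow> int (c'' v) = int (c' v) - lap (int \<circ> (\<lambda>v. 1 - y v)) v"
    "\<And>v. v \<notin> N \<Longrightarrow> c'' v = c' v"
    using multi_topple[of "\<lambda>v. 1 - y v" c'] by blast
  have "c'' v = ?c v" for v
  proof (cases "v \<in> N")
    case True
    \<comment> \<open>Together the two rounds topple each vertex exactly once, which cancels the
      firing of the sink.\<close>
    have "(\<lambda>v. (int \<circ> y) v + (int \<circ> (\<lambda>v. 1 - y v)) v) = int \<circ> (\<lambda>_. 1)"
      using y_le by (auto simp: of_nat_diff)
    then have "lap (int \<circ> y) v + lap (int \<circ> (\<lambda>v. 1 - y v)) v = int (E None v)"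
      using lap_add[of "int \<circ> y" "int \<circ> (\<lambda>v. 1 - y v)" v] lap_ones[of 1 v] by simp
    then show ?thesis using c'(2)[OF True] c''(2)[OF True] by simp
  next
    case False
    then show ?thesis using c'(3) c''(3) E_sink_outside by simp
  qed
  then have "c'' = ?c" by (rule ext)
  then have "T\<^sup>*\<^sup>* (\<lambda>v. ?c v + E None v) ?c"
    using rtranclp_trans[OF c'(1) c''(1)] by simp
  then show "stab (\<lambda>v. ?c v + E None v) = ?c"
    using stable by (rule stab_eqI)
qed

text \<open>Twice the configuration is a constant plus \<open>(r - t)\<close> times
  \<open>chi b\<close>, and a character of positive weight is orthogonal to constants. The doubling
  avoids halves.\<close>

lemma phi_K_conf:
  assumes b: "b \<in> V" and g: "g \<in> V" and pos: "sum_list g \<noteq> 0"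
  shows "2 * phi g (int \<circ> K_conf d b r t) = (if g = b then 2 ^ d * (int r - int t) else 0)"
proof -
  define u where "u = int r + int t + 2 * int (d - sum_list b)"
  have val: "2 * int (K_conf d b r t (Some a)) = u + (int r - int t) * chi b a" if "a \<in> V" for a
    using that by (simp add: K_conf_Some u_def chi_def)
  have "2 * phi g (int \<circ> K_conf d b r t) = (\<Sum>a\<in>V. chi g a * (2 * int (K_conf d b r t (Some a))))"
    by (simp add: phi_def sum_distrib_left mult.left_commute)
  also have "\<dots> = (\<Sum>a\<in>V. u * chi g a + (int r - int t) * (chi g a * chi b a))"
    by (intro sum.cong) (simp_all add: val algebra_simps)
  also have "\<dots> = u * (\<Sum>a\<in>V. chi g a) + (int r - int t) * (\<Sum>a\<in>V. chi g a * chi b a)"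
    by (simp add: sum.distrib sum_distrib_left)
  finally show ?thesis
    unfolding sum_chi[OF g pos] chi_orthogonal[OF g b] by simp
qed

text \<open>With \<open>n = 1\<close> the zero vector has modulus 1, so its invariant carries no
  information.\<close>

lemma modulus_trivial: "sum_list g = 0 \<Longrightarrow> [x = y] (mod modulus g)"
  by (simp only: cong_def n_eq mult_0_right add_0 of_nat_1 mod_by_1)

text \<open>The difference \<open>r - t\<close> runs through all integers from \<open>- |b|\<close>
  to \<open>|b|\<close>, a full residue system modulo \<open>2 * |b| + 1\<close>. As 2 is invertible
  there, every value of the invariant at \<open>b\<close> is attained.\<close>

lemma K_tilde_isotypic:
  assumes b: "b \<in> V"
  shows "K_tilde d b = isotypic b"
proof (intro equalityI subsetI)
  fix c assume "c \<in> K_tilde d b"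
  then obtain r t where rt: "r \<le> sum_list b" "t \<le> sum_list b" "r = sum_list b \<or> t = sum_list b"
    and c: "c = K_conf d b r t"
    unfolding K_tilde_eq by blast
  have "[phi g (int \<circ> c) = 0] (mod modulus g)" if "g \<in> V" "g \<noteq> b" for g
  proof (cases "sum_list g = 0")
    case True
    then show ?thesis by (rule modulus_trivial)
  next
    case False
    then have "phi g (int \<circ> c) = 0"
      using phi_K_conf[OF b that(1) False, of r t] that(2) by (simp add: c)
    then show ?thesis by simp
  qed
  then show "c \<in> isotypic b"
    using K_conf_recurrent[OF b rt] by (simp add: isotypic_def c)
next
  fix c assume c: "c \<in> isotypic b"
  let ?m = "int (sum_list b)"
  obtain e where e: "[2 ^ d * e = 2 * phi b (int \<circ> c)] (mod modulus b)"
    using solve_mod by blast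
  \<comment> \<open>The representative of \<open>e\<close> in the symmetric interval from
    \<open>- ?m\<close> to \<open>?m\<close>.\<close>
  define e' where "e' = (e + ?m) mod modulus b - ?m"
  have e'_cong: "[e' = e] (mod modulus b)"
    unfolding e'_def cong_def by (simp add: mod_diff_left_eq)
  have modulus_eq: "modulus b = 2 * ?m + 1"
    by (simp add: n_eq)
  then have "modulus b > 0"
    by linarith
  then have e'_range: "- ?m \<le> e'" "e' \<le> ?m"
    using pos_mod_sign[of "modulus b" "e + ?m"] pos_mod_bound[of "modulus b" "e + ?m"] modulus_eq
    unfolding e'_def by linarith+
  \<comment> \<open>The pair with difference \<open>e'\<close> whose larger entry is
    \<open>?m\<close>.\<close>
  define r t where "r = nat (if 0 \<le> e' then ?m else ?m + e')" and "t = nat (if 0 \<le> e' then ?m - e' else ?m)"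
  have rt: "r \<le> sum_list b" "t \<le> sum_list b" "r = sum_list b \<or> t = sum_list b"
    using e'_range by (auto simp: r_def t_def)
  have rt_diff: "int r - int t = e'"
    using e'_range by (simp add: r_def t_def)
  have "K_conf d b r t = c"
  proof (rule recurrent_cong_unique)
    show "rec (K_conf d b r t)" using b rt by (rule K_conf_recurrent)
    show "rec c" using c by (simp add: isotypic_def)
    fix g assume g: "g \<in> V"
    show "[phi g (int \<circ> K_conf d b r t) = phi g (int \<circ> c)] (mod modulus g)"
    proof (cases "sum_list g = 0")
      case True
      then show ?thesis by (rule modulus_trivial)
    next
      case False
      note phi = phi_K_conf[OF b g False, of r t]
      show ?thesis
      proof (cases "g = b")
        case True
        have "[2 ^ d * e' = 2 ^ d * e] (mod modulus b)"
          using e'_cong by (rule cong_scalar_left)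
        then have "[2 * phi b (int \<circ> K_conf d b r t) = 2 * phi b (int \<circ> c)] (mod modulus b)"
          using phi e cong_trans unfolding True rt_diff by (metis (full_types))
        moreover have "coprime 2 (modulus b)" by (simp add: n_eq)
        ultimately show ?thesis
          unfolding True by (simp add: cong_mult_lcancel)
      next
        case False
        then have "[phi g (int \<circ> c) = 0] (mod modulus g)"
          using c g by (simp add: isotypic_def)
        then show ?thesis using phi False by (simp add: cong_sym)
      qed
    qed
  qed
  then show "c \<in> K_tilde d b"
    using rt unfolding K_tilde_eq by blast
qed

lemma internal_direct_sum_K_tilde: "internal_direct_sum SP V (K_tilde d)"
proof -
  have "(\<Pi>\<^sub>E b\<in>V. K_tilde d b) = (\<Pi>\<^sub>E b\<in>V. isotypic b)"
    by (intro PiE_cong K_tilde_isotypic)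
  then show ?thesis
    using internal_direct_sum_isotypic by (simp add: internal_direct_sum_def K_tilde_isotypic)
qed

end

theorem theorem5p3:
  fixes k d :: nat
  assumes "d \<ge> 1"
  shows "sandpile_group (n_cone (2 * k + 1) (hypercube d)) None \<cong>
           sum_group {0..d} (\<lambda>i. sum_group {..<d choose i}
             (\<lambda>_. integer_mod_group (2 * i + 2 * k + 1)))
         \<and> internal_direct_sum (sandpile_group (n_cone 1 (hypercube d)) None)
             (bit_vectors d) (K_tilde d)"
proof
  interpret cube_cone d "2 * k + 1" by unfold_locales simp
  show "sandpile_group (n_cone (2 * k + 1) (hypercube d)) None \<cong>
           sum_group {0..d} (\<lambda>i. sum_group {..<d choose i}
             (\<lambda>_. integer_mod_group (2 * i + 2 * k + 1)))"
    \<comment> \<open>Regrouping matches the orders \<open>2 * i + 2 * k + 1\<close> with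
      \<open>2 * i + n\<close> for \<open>n = 2 * k + 1\<close>.\<close>
    using residues_iso unfolding is_iso_def add.assoc by blast
next
  interpret cube_cone1 d 1 by unfold_locales simp_all
  show "internal_direct_sum (sandpile_group (n_cone 1 (hypercube d)) None) (bit_vectors d) (K_tilde d)"
    by (rule internal_direct_sum_K_tilde)
qed

end
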